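(* Let $n\ge2$ and let $h$ be a generic homogeneous polynomial of degree $n+1$ on $\mathbb C^2$ with $\|h\|_{\max}=1$. Then one can choose a $d$-standard form tuple $\Omega$ so that $$|C(h,\Omega)|>(c'(h))^{6n^3}\,n^{-60n^3}.$$
   Context: A homogeneous polynomial is generic if it has only simple zero lines. $\|h\|_{\max}=\max_{|x|^2+|y|^2=1}|h(x,y)|$. Distance between complex lines through $0$ in $\mathbb C^2$ is the Fubini–Study distance on $\mathbb{CP}^1$, normalized as the angle: for lines spanned by unit vectors $u,v$ it is $\arccos|(u,v)|\in[0,\pi/2]$. $c_1(h)=n\cdot$(smallest distance between two distinct zero lines of $h$), $c'(h)=\min(c_1(h),1)$. A tuple $\Omega=(\omega_1,\dots,\omega_{n^2})$ of monomial 1-forms of the type $x^ly^{m+1}dx$ (degree $l+m+1$) is standard if all degrees are at most $2n-1$ and all the forms $x^ly^{m+1}dx$ with $0\le l+m\le n-1$ are contained in it; it is $d$-standard if moreover for every $d$ with $n\le d\le2n-2$ it contains exactly $2n-d-1$ forms of degree $d+1$. The constant $C(h,\Omega)$ is $$C(h,\Omega)=C_n\,(\Sigma(h))^{\frac12-n}\prod_{d=n}^{2n-2}P_d(h,\Omega),$$ $$C_n=(-1)^{\frac{n(3n-1)}4}\frac{(2\pi)^{\frac{n(n+1)}2}(n+1)^{\frac{n^2+n-4}2}((n+1)!)^n}{\prod_{m=1}^{n-1}(m+n+1)!}.$$ Here $\Sigma(h)$ is the discriminant: if $h=c_{-1}\prod_{i=0}^n(y-c_ix)$, then $\Sigma(h)=c_{-1}^{2n}\prod_{0\le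 j<i\le n}(c_i-c_j)^2$; in general, if $h=\prod_{i=0}^n(v_{i,1}x+v_{i,2}y)$, then $\Sigma(h)=\prod_{i<j}(v_{i,1}v_{j,2}-v_{i,2}v_{j,1})^2$. $P_d(h,\Omega)=\det A_d(h,\Omega(d))$, where $\Omega(d)=(\omega'_1,\dots,\omega'_{2n-d-1})$ is the tuple of forms of degree $d+1$ in $\Omega$ (in the order of $\Omega$), and $A_d$ is the $(d+1)\times(d+1)$ matrix whose columns are numbered by the monomials $y^d,y^{d-1}x,\dots,x^d$ and whose rows consist of the coefficients of the following degree $d$ polynomials: the $d-n+1$ polynomials $x^jy^{d-n-j}\frac{\partial h}{\partial y}$, $0\le j\le d-n$; the $2n-d-1$ polynomials $\frac{D\omega'_r}{n-r+1}$, $r=1,\dots,2n-d-1$; the $d-n+1$ polynomials $x^jy^{d-n-j}\frac{\partial h}{\partial x}$, $0\le j\le d-n$. For a polynomial 1-form $\omega$, $D\omega$ is the polynomial defined by $d\omega=D\omega\,dx\wedge dy$. *)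

theory Defs
  imports
    "HOL-Analysis.Complex_Transcendental"
    "HOL-Computational_Algebra.Computational_Algebra"
    "HOL-Computational_Algebra.Field_as_Ring"
    "Jordan_Normal_Form.Determinant"
begin

text \<open>A polynomial in \<open>x, y\<close> is an element of \<open>(\<complex>[x])[y]\<close>: the outer variable is \<open>y\<close>, the inner
  one is \<open>x\<close>.\<close>

type_synonym cpoly2 = "complex poly poly"

definition coeff2 :: "cpoly2 \<Rightarrow> nat \<Rightarrow> nat \<Rightarrow> complex" where
  "coeff2 p i j = coeff (coeff p j) i"  (* coefficient of x^i y^j *)

definition eval2 :: "cpoly2 \<Rightarrow> complex \<times> complex \<Rightarrow> complex" where
  "eval2 p v = poly (poly p [:snd v:]) (fst v)"

definition monom2 :: "nat \<Rightarrow> nat \<Rightarrow> cpoly2" where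
  "monom2 i j = monom (monom 1 i) j"  (* x^i y^j *)

definition pderiv_x :: "cpoly2 \<Rightarrow> cpoly2" where
  "pderiv_x p = map_poly pderiv p"

definition pderiv_y :: "cpoly2 \<Rightarrow> cpoly2" where
  "pderiv_y p = pderiv p"

definition linear2 :: "complex \<times> complex \<Rightarrow> cpoly2" where
  "linear2 v = [:[:0, fst v:], [:snd v:]:]"  (* fst v * x + snd v * y *)

text \<open>The zero polynomial is homogeneous of every degree.\<close>

definition homogeneous2 :: "nat \<Rightarrow> cpoly2 \<Rightarrow> bool" where
  "homogeneous2 d p \<longleftrightarrow> (\<forall>i j. coeff2 p i j \<noteq> 0 \<longrightarrow> i + j = d)"


definition cspan :: "complex \<times> complex \<Rightarrow> (complex \<times> complex) set" where
  "cspan v = range (\<lambda>t. (t * fst v, t * snd v))"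

definition zero_lines :: "cpoly2 \<Rightarrow> (complex \<times> complex) set set" where
  "zero_lines h = {cspan v | v. v \<noteq> 0 \<and> eval2 h v = 0}"

text \<open>The line spanned by \<open>(a, b)\<close> is the zero set of \<open>b x - a y\<close>; its multiplicity as a zero
  line of \<open>h\<close> is the multiplicity of this factor in \<open>h\<close>. Since \<open>multiplicity p 0 = 0\<close>, the zero
  polynomial is not generic.\<close>

definition generic2 :: "cpoly2 \<Rightarrow> bool" where
  "generic2 h \<longleftrightarrow>
     (\<forall>a b. (a, b) \<noteq> (0, 0) \<and> cspan (a, b) \<in> zero_lines h \<longrightarrow>
        multiplicity (linear2 (b, - a)) h = 1)"

text \<open>The supremum is a maximum, by compactness of the unit sphere.\<close>

definition max_norm2 :: "cpoly2 \<Rightarrow> real" where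
  "max_norm2 h = (SUP (x, y) \<in> {(x, y). (cmod x)\<^sup>2 + (cmod y)\<^sup>2 = 1}. cmod (eval2 h (x, y)))"


definition hermitian2 :: "complex \<times> complex \<Rightarrow> complex \<times> complex \<Rightarrow> complex" where
  "hermitian2 u v = fst u * cnj (fst v) + snd u * cnj (snd v)"

definition fubini_study :: "(complex \<times> complex) set \<Rightarrow> (complex \<times> complex) set \<Rightarrow> real" where
  "fubini_study L M =
     (THE r. \<exists>u v. norm u = 1 \<and> norm v = 1 \<and> L = cspan u \<and> M = cspan v \<and>
        r = arccos (cmod (hermitian2 u v)))"

lemma cspan_unit_eqD:
  assumes "norm u = 1" "norm u' = 1" "cspan u = cspan u'"
  obtains t where "cmod t = 1" "u' = (t * fst u, t * snd u)"
proof -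
  have "u' \<in> cspan u'"
    unfolding cspan_def by (rule range_eqI[of _ _ 1]) simp
  then obtain t where t: "u' = (t * fst u, t * snd u)"
    using assms(3) by (auto simp: cspan_def)
  have "norm u' = sqrt ((cmod t)\<^sup>2 * ((cmod (fst u))\<^sup>2 + (cmod (snd u))\<^sup>2))"
    by (simp add: t norm_prod_def norm_mult power_mult_distrib algebra_simps)
  also have "\<dots> = cmod t * norm u"
    by (simp add: norm_prod_def real_sqrt_mult)
  finally show thesis using that assms t by simp
qed

lemma fubini_study_cspan:
  assumes "norm u = 1" "norm v = 1"
  shows "fubini_study (cspan u) (cspan v) = arccos (cmod (hermitian2 u v))"
  unfolding fubini_study_def
proof (rule the_equality)
  fix r
  assume "\<exists>u' v'. norm u' = 1 \<and> norm v' = 1 \<and> cspan u = cspan u' \<and> cspan v = cspan v' \<and>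
    r = arccos (cmod (hermitian2 u' v'))"
  then obtain u' v' where *: "norm u' = 1" "norm v' = 1" "cspan u = cspan u'" "cspan v = cspan v'"
    "r = arccos (cmod (hermitian2 u' v'))" by blast
  obtain s where s: "cmod s = 1" "u' = (s * fst u, s * snd u)"
    using cspan_unit_eqD assms * by metis
  obtain t where t: "cmod t = 1" "v' = (t * fst v, t * snd v)"
    using cspan_unit_eqD assms * by metis
  have "hermitian2 u' v' = s * cnj t * hermitian2 u v"
    by (simp add: hermitian2_def s t algebra_simps)
  then show "r = arccos (cmod (hermitian2 u v))"
    using * s t by (simp add: norm_mult)
qed (use assms in blast)

definition c1 :: "nat \<Rightarrow> cpoly2 \<Rightarrow> real" where
  "c1 n h = real n * Min {fubini_study L M | L M. L \<in> zero_lines h \<and> M \<in> zero_lines h \<and> L \<noteq> M}"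

definition c_prime :: "nat \<Rightarrow> cpoly2 \<Rightarrow> real" where
  "c_prime n h = min (c1 n h) 1"


text \<open>The pair \<open>(P, Q)\<close> is the polynomial 1-form \<open>P dx + Q dy\<close>, so
  \<open>d(P dx + Q dy) = (\<partial>Q/\<partial>x - \<partial>P/\<partial>y) dx \<and> dy\<close>. The degree of a form is that of its coefficients.\<close>

type_synonym form1 = "cpoly2 \<times> cpoly2"

definition D_form :: "form1 \<Rightarrow> cpoly2" where
  "D_form \<omega> = pderiv_x (snd \<omega>) - pderiv_y (fst \<omega>)"

definition monomial_form :: "nat \<Rightarrow> nat \<Rightarrow> form1" where
  "monomial_form l m = (monom2 l (m + 1), 0)"

definition homogeneous_form :: "nat \<Rightarrow> form1 \<Rightarrow> bool" where
  "homogeneous_form e \<omega> \<longleftrightarrow> homogeneous2 e (fst \<omega>) \<and> homogeneous2 e (snd \<omega>)"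

text \<open>\<open>forms_of_degree e \<Omega>\<close> keeps the order of \<open>\<Omega>\<close>; the tuple written \<open>\<Omega>(d)\<close> is
  \<open>forms_of_degree (d + 1) \<Omega>\<close>.\<close>

definition forms_of_degree :: "nat \<Rightarrow> form1 list \<Rightarrow> form1 list" where
  "forms_of_degree e \<Omega> = filter (homogeneous_form e) \<Omega>"

definition standard_tuple :: "nat \<Rightarrow> form1 list \<Rightarrow> bool" where
  "standard_tuple n \<Omega> \<longleftrightarrow>
     length \<Omega> = n\<^sup>2 \<and>
     (\<forall>\<omega> \<in> set \<Omega>. \<exists>l m. \<omega> = monomial_form l m \<and> l + m + 1 \<le> 2 * n - 1) \<and>
     (\<forall>l m. l + m \<le> n - 1 \<longrightarrow> monomial_form l m \<in> set \<Omega>)"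

definition d_standard_tuple :: "nat \<Rightarrow> form1 list \<Rightarrow> bool" where
  "d_standard_tuple n \<Omega> \<longleftrightarrow>
     standard_tuple n \<Omega> \<and>
     (\<forall>d \<in> {n..2 * n - 2}. length (forms_of_degree (d + 1) \<Omega>) = 2 * n - d - 1)"


text \<open>The value does not depend on the chosen factorization: rescaling the factors by numbers
  \<open>\<lambda>\<^sub>i\<close> with product 1 multiplies it by \<open>(\<Prod>i. \<lambda>\<^sub>i) ^ (2 * n) = 1\<close>.\<close>

definition Sigma_disc :: "nat \<Rightarrow> cpoly2 \<Rightarrow> complex" where
  "Sigma_disc n h =
     (let v = (SOME v :: nat \<Rightarrow> complex \<times> complex. h = (\<Prod>i\<le>n. linear2 (v i)))
      in \<Prod>j\<le>n. \<Prod>i<j. (fst (v i) * snd (v j) - snd (v i) * fst (v j))\<^sup>2)"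

text \<open>List entries are numbered from 0, so \<open>\<omega>'\<^sub>r\<close> is entry \<open>r - 1\<close>.\<close>

definition A_rows :: "nat \<Rightarrow> nat \<Rightarrow> cpoly2 \<Rightarrow> form1 list \<Rightarrow> cpoly2 list" where
  "A_rows n d h \<Omega>d =
     map (\<lambda>j. monom2 j (d - n - j) * pderiv_y h) [0..<d - n + 1] @
     map (\<lambda>r. Polynomial.smult [:1 / (of_nat n - of_nat r + 1):] (D_form (\<Omega>d ! (r - 1)))) [1..<2 * n - d] @
     map (\<lambda>j. monom2 j (d - n - j) * pderiv_x h) [0..<d - n + 1]"

definition A_mat :: "nat \<Rightarrow> nat \<Rightarrow> cpoly2 \<Rightarrow> form1 list \<Rightarrow> complex mat" where
  "A_mat n d h \<Omega>d = Matrix.mat (d + 1) (d + 1) (\<lambda>(i, k). coeff2 (A_rows n d h \<Omega>d ! i) k (d - k))"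

definition P_det :: "nat \<Rightarrow> nat \<Rightarrow> cpoly2 \<Rightarrow> form1 list \<Rightarrow> complex" where
  "P_det n d h \<Omega> = Determinant.det (A_mat n d h (forms_of_degree (d + 1) \<Omega>))"

text \<open>The fractional powers of complex numbers in \<open>C_n\<close> and \<open>C_const\<close> are principal values
  (exponents are real, so the modulus of the result does not depend on the branch).\<close>

definition C_n :: "nat \<Rightarrow> complex" where
  "C_n n = (- 1) powr (of_nat n * (3 * of_nat n - 1) / 4) *
     of_real ((2 * pi) powr (real n * (real n + 1) / 2) *
       (real n + 1) powr (((real n)\<^sup>2 + real n - 4) / 2) *
       (fact (n + 1)) ^ n / (\<Prod>m = 1..n - 1. fact (m + n + 1)))"

definition C_const :: "nat \<Rightarrow> cpoly2 \<Rightarrow> form1 list \<Rightarrow> complex" where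
  "C_const n h \<Omega> =
     C_n n * Sigma_disc n h powr (1 / 2 - of_nat n) * (\<Prod>d = n..2 * n - 2. P_det n d h \<Omega>)"

end

theory Submission imports Defs begin

text \<open>
  Since \<open>0 \<le> c'(h) \<le> 1\<close>, it is enough to find \<open>\<Omega>\<close> with \<open>\<bar>C(h, \<Omega>)\<bar> > n^(-60 n^3)\<close>. The negative power of
  the discriminant \<open>\<Sigma>\<close> in \<open>C(h, \<Omega>)\<close> has to be compared with the product of the \<open>n - 1\<close> determinants
  \<open>P\<^sub>d\<close>, and both are controlled by one quantity: the modulus \<open>R\<close> of the Sylvester determinant whose
  rows are the \<open>2 n\<close> forms \<open>x\<^sup>j y\<^bsup>n-1-j\<^esup> \<partial>h/\<partial>x\<close>, \<open>x\<^sup>j y\<^bsup>n-1-j\<^esup> \<partial>h/\<partial>y\<close> of degree \<open>2 n - 1\<close>.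

  On the one hand \<open>R = (n + 1)\<^bsup>n-1\<^esup> \<bar>\<Sigma>\<bar>\<close> (\<open>absdet_sylvester_partials\<close>). In particular
  \<open>0 < \<bar>\<Sigma>\<bar> \<le> R\<close>, because the zero lines of a generic form are distinct.

  On the other hand, the rows of \<open>P\<^sub>d\<close> that come from monomial forms are multiples of unit rows. So
  \<open>P\<^sub>d\<close> is, up to harmless factors, a minor of the matrix formed by the rows
  \<open>x\<^sup>j y\<^bsup>d-n-j\<^esup> \<partial>h/\<partial>x\<close>, \<open>x\<^sup>j y\<^bsup>d-n-j\<^esup> \<partial>h/\<partial>y\<close>, and the choice of the forms of degree \<open>d + 1\<close> is the
  choice of the minor. The same rows, multiplied by a power of \<open>y\<close>, are rows of the Sylvester
  matrix. Replacing the other Sylvester rows one after another by the best unit row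
  costs at most a factor \<open>L\<close> each time, if \<open>L\<close> bounds the sum of the moduli of the entries of a row. Hence for
  a good choice of the forms \<open>\<bar>P\<^sub>d\<bar> \<ge> R n\<^bsup>-2n\<^esup> L\<^bsup>-2n\<^esup>\<close> (\<open>absdet_sylvester_minors\<close>,
  \<open>P_det_ge_absdet\<close>). Replacing all the rows gives \<open>R \<le> L\<^bsup>2n\<^esup>\<close>.

  Multiplying, \<open>\<bar>\<Sigma>\<bar>\<^bsup>1/2-n\<^esup> \<Prod>\<bar>P\<^sub>d\<bar>\<close> is at least \<open>R\<^bsup>1/2-n\<^esup> R\<^bsup>n-1\<^esup> = R\<^bsup>-1/2\<^esup> \<ge> L\<^bsup>-n\<^esup>\<close> up to a factor
  \<open>(n L)\<^bsup>-2n(n-1)\<^esup>\<close>. Finally, the normalization of \<open>h\<close> bounds its coefficients by the Cauchy estimate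
  (\<open>norm_coeff_dehomogenize_le\<close>), so that \<open>L = n\<^bsup>3n\<^esup>\<close> is possible, and the factor \<open>C\<^sub>n\<close> is at least
  \<open>n^(-4 n^2)\<close>. The exponents of \<open>n\<close> add up to less than \<open>60 n^3\<close>.

  The computations are carried out with \<open>f = h(x, 1)\<close>; a form of known degree is determined by its value at
  \<open>y = 1\<close>, and multiplication by \<open>y\<close> becomes invisible.
\<close>

section \<open>Determinants of lists of coefficient rows\<close>

text \<open>The sign is dropped so that the rows may be listed in any order. Coefficients from \<open>N\<close> on are
  cut off.\<close>

definition absdet :: "nat \<Rightarrow> complex poly list \<Rightarrow> real" where
  "absdet N ps = cmod (Determinant.det (Matrix.mat N N (\<lambda>(i, k). coeff (ps ! i) k)))"

lemma absdet_mset_cong: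
  assumes "mset ps = mset qs" "length qs = N"
  shows "absdet N ps = absdet N qs"
proof -
  obtain p where p: "p permutes {..<length qs}" "permute_list p qs = ps"
    using mset_eq_permutation[OF assms(1)] by metis
  have p': "p permutes {0..<N}" using p(1) assms(2) by (simp add: lessThan_atLeast0)
  define A where "A = Matrix.mat N N (\<lambda>(i, k). coeff (qs ! i) k)"
  have lt: "p i < N" if "i < N" for i using permutes_in_image[OF p'] that by auto
  have "Matrix.mat N N (\<lambda>(i, k). coeff (ps ! i) k) = Matrix.mat N N (\<lambda>(i, k). A $$ (p i, k))"
    unfolding A_def using lt permute_list_nth[OF p(1)] assms(2) p(2)
    by (intro eq_matI) auto
  moreover have "Determinant.det (Matrix.mat N N (\<lambda>(i, k). A $$ (p i, k))) = signof p * Determinant.det A"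
    by (rule det_permute_rows[OF _ p']) (auto simp: A_def)
  ultimately show ?thesis
    by (simp add: absdet_def A_def norm_mult sign_def)
qed

text \<open>The cofactors along the first row do not see that row. They are therefore the same for every
  \<open>q\<close>, in particular for a unit row, whose determinant is a single cofactor.\<close>

lemma absdet_Cons_expand:
  assumes "length ps = N"
  shows "Determinant.det (Matrix.mat (Suc N) (Suc N) (\<lambda>(i, k). coeff ((p # ps) ! i) k))
    = (\<Sum>c<Suc N. coeff p c * cofactor (Matrix.mat (Suc N) (Suc N) (\<lambda>(i, k). coeff ((q # ps) ! i) k)) 0 c)"
proof -
  have *: "cofactor (Matrix.mat (Suc N) (Suc N) (\<lambda>(i, k). coeff ((p # ps) ! i) k)) 0 c
      = cofactor (Matrix.mat (Suc N) (Suc N) (\<lambda>(i, k). coeff ((q # ps) ! i) k)) 0 c" for c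
    unfolding cofactor_def mat_delete_def
    by (intro arg_cong2[where f = "(*)"] refl arg_cong[where f = Determinant.det] eq_matI) auto
  show ?thesis
    by (subst laplace_expansion_row[of _ "Suc N" 0]) (simp_all add: *)
qed

lemma absdet_monom_Cons:
  assumes "length ps = N" "c < Suc N"
  shows "absdet (Suc N) (monom 1 c # ps) =
    cmod (cofactor (Matrix.mat (Suc N) (Suc N) (\<lambda>(i, k). coeff ((q # ps) ! i) k)) 0 c)"
proof -
  have "(\<Sum>k<Suc N. coeff (monom 1 c) k * g k) = g c" for g :: "nat \<Rightarrow> complex"
    using assms(2) by (subst sum.remove[of _ c]) (auto simp: sum.neutral)
  then show ?thesis
    unfolding absdet_def absdet_Cons_expand[OF assms(1), of _ q] by simp
qed

text \<open>The determinant is linear in its first row, hence a combination, with weights of total mass at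
  most \<open>L\<close>, of determinants in which that row is a unit row. The largest of these will do. Iterating
  this gives what a Laplace expansion along several rows would give, with no sum over minors.\<close>

lemma absdet_replace_row:
  assumes "length ps = N" "(\<Sum>c<Suc N. cmod (coeff p c)) \<le> L"
  obtains c where "c < Suc N" "absdet (Suc N) (p # ps) \<le> L * absdet (Suc N) (monom 1 c # ps)"
proof -
  define g where "g c = absdet (Suc N) (monom 1 c # ps)" for c
  define m where "m = Max (g ` {..<Suc N})"
  have "m \<in> g ` {..<Suc N}" unfolding m_def by (rule Max_in) auto
  then obtain c where c: "c < Suc N" "m = g c" by auto
  have le: "g k \<le> g c" if "k < Suc N" for k
    using that unfolding c(2)[symmetric] m_def by (intro Max_ge) auto
  have "absdet (Suc N) (p # ps) \<le> (\<Sum>k<Suc N. cmod (coeff p k) * g k)"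
    unfolding absdet_def absdet_Cons_expand[OF assms(1), of p p] g_def
    using absdet_monom_Cons[OF assms(1), of _ p]
    by (intro order.trans[OF norm_sum] sum_mono) (simp add: norm_mult absdet_def)
  also have "\<dots> \<le> (\<Sum>k<Suc N. cmod (coeff p k) * g c)"
    using le by (intro sum_mono mult_left_mono) auto
  also have "\<dots> = (\<Sum>k<Suc N. cmod (coeff p k)) * g c" by (simp only: sum_distrib_right)
  also have "\<dots> \<le> L * g c"
    using assms(2) by (intro mult_right_mono) (auto simp: g_def absdet_def)
  finally show thesis using that[OF c(1)] by (simp add: g_def)
qed

lemma absdet_drop_top_monom:
  assumes "length ps = N"
  shows "absdet (Suc N) (monom 1 N # ps) = absdet N ps"
proof -
  have "mat_delete (Matrix.mat (Suc N) (Suc N) (\<lambda>(i, k). coeff ((0 # ps) ! i) k)) 0 N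
     = Matrix.mat N N (\<lambda>(i, k). coeff (ps ! i) k)"
    unfolding mat_delete_def by (intro eq_matI) auto
  then show ?thesis
    unfolding absdet_monom_Cons[OF assms, of N 0, simplified]
    by (simp add: cofactor_def absdet_def norm_mult norm_power)
qed

lemma absdet_nonzero_col:
  assumes "absdet N ps \<noteq> 0" "length ps = N" "k < N"
  shows "\<exists>p\<in>set ps. coeff p k \<noteq> 0"
proof (rule ccontr)
  assume "\<not> (\<exists>p\<in>set ps. coeff p k \<noteq> 0)"
  then have z: "coeff (ps ! i) k = 0" if "i < N" for i
    using that assms(2) that nth_mem by blast
  have "absdet N ps = 0"
    unfolding absdet_def using z assms(3)
    by (subst laplace_expansion_column[of _ N k]) auto
  with assms(1) show False by simp
qed

lemma absdet_nonzero_row: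
  assumes "absdet N ps \<noteq> 0" "length ps = N" "p \<in> set ps"
  shows "\<exists>k<N. coeff p k \<noteq> 0"
proof (rule ccontr)
  assume "\<not> (\<exists>k<N. coeff p k \<noteq> 0)"
  then have z: "coeff p k = 0" if "k < N" for k using that by blast
  obtain i where i: "i < N" "ps ! i = p" using assms by (metis in_set_conv_nth)
  have "absdet N ps = 0"
    unfolding absdet_def using z i
    by (subst laplace_expansion_row[of _ N i]) auto
  with assms(1) show False by simp
qed

text \<open>A square matrix of unit rows is singular or a permutation matrix.\<close>

lemma absdet_monoms_le_1:
  "length cs = N \<Longrightarrow> absdet N (map (monom 1) cs) \<le> 1"
proof (induction N arbitrary: cs)
  case 0
  then show ?case by (simp add: absdet_def det_dim_zero)
next
  case (Suc N)
  show ?case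
  proof (cases "absdet (Suc N) (map (monom 1) cs) = 0")
    case False
    have "\<exists>p\<in>set (map (monom (1 :: complex)) cs). coeff p N \<noteq> 0"
      by (rule absdet_nonzero_col[OF False]) (use Suc.prems in auto)
    then have N: "N \<in> set cs" by (auto split: if_splits)
    have "mset cs = mset (N # remove1 N cs)" using N by simp
    then have "mset (map (monom 1) cs) = mset (map (monom 1 :: nat \<Rightarrow> complex poly) (N # remove1 N cs))"
      unfolding mset_map by (rule arg_cong)
    then have "absdet (Suc N) (map (monom 1) cs) = absdet (Suc N) (map (monom 1) (N # remove1 N cs))"
      by (rule absdet_mset_cong) (use Suc.prems N in \<open>auto simp: length_remove1\<close>)
    also have "\<dots> = absdet N (map (monom 1) (remove1 N cs))"
      using absdet_drop_top_monom[of "map (monom 1) (remove1 N cs)" N] Suc.prems N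
      by (simp add: length_remove1)
    also have "\<dots> \<le> 1" using Suc.prems N by (intro Suc.IH) (simp add: length_remove1)
    finally show ?thesis .
  qed simp
qed

text \<open>Every term of the Leibniz expansion picks up each row factor and each column factor exactly once.\<close>

lemma det_scale:
  fixes g :: "nat \<Rightarrow> nat \<Rightarrow> complex"
  shows "Determinant.det (Matrix.mat N N (\<lambda>(i, j). r i * c j * g i j))
    = (\<Prod>i<N. r i) * (\<Prod>j<N. c j) * Determinant.det (Matrix.mat N N (\<lambda>(i, j). g i j))"
proof -
  have "(\<Prod>i=0..<N. r i * c (p i) * g i (p i)) = (\<Prod>i<N. r i) * (\<Prod>j<N. c j) * (\<Prod>i=0..<N. g i (p i))"
    if "p permutes {0..<N}" for p
    using prod.permute[OF that, of c] by (simp add: prod.distrib lessThan_atLeast0 comp_def)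
  moreover have "(\<Prod>i=0..<N. (Matrix.mat N N (\<lambda>(i, j). F i j)) $$ (i, p i)) = (\<Prod>i=0..<N. F i (p i))"
    if "p permutes {0..<N}" for p and F :: "nat \<Rightarrow> nat \<Rightarrow> complex"
    using permutes_in_image[OF that] by (intro prod.cong) auto
  ultimately show ?thesis
    by (simp add: det_def'[of _ N] sum_distrib_left mult_ac)
qed

lemma absdet_ge_scaled_rows:
  assumes "length ps = N" "length qs = N" "0 \<le> e"
    and "\<And>i. i < N \<Longrightarrow> \<exists>r. ps ! i = Polynomial.smult r (qs ! i) \<and> e \<le> cmod r"
  shows "e ^ N * absdet N qs \<le> absdet N ps"
proof -
  obtain r where r: "\<And>i. i < N \<Longrightarrow> ps ! i = Polynomial.smult (r i) (qs ! i) \<and> e \<le> cmod (r i)"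
    using assms(4) by metis
  have "Matrix.mat N N (\<lambda>(i, k). coeff (ps ! i) k) = Matrix.mat N N (\<lambda>(i, k). r i * 1 * coeff (qs ! i) k)"
    using r by (intro eq_matI) auto
  then have "absdet N ps = (\<Prod>i<N. cmod (r i)) * absdet N qs"
    unfolding absdet_def by (simp only: det_scale) (simp add: norm_mult prod_norm)
  moreover have "(\<Prod>i<N. e) \<le> (\<Prod>i<N. cmod (r i))"
    using r assms(3) by (intro prod_mono) auto
  ultimately show ?thesis by (simp add: mult_right_mono absdet_def)
qed

section \<open>Minors of the Sylvester matrix, completed by unit rows\<close>

text \<open>With \<open>p\<close> read as the value at \<open>y = 1\<close> of a form \<open>q\<close> of degree \<open>n\<close>, these are the values at
  \<open>y = 1\<close> of the forms \<open>x\<^sup>j y\<^bsup>e-j\<^esup> q\<close>, \<open>j < k\<close>, whatever the total degree \<open>n + e\<close> is. So one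
  list serves all the degrees \<open>d\<close> that occur.\<close>

definition shifts :: "nat \<Rightarrow> complex poly \<Rightarrow> complex poly list" where
  "shifts k p = map (\<lambda>j. monom 1 j * p) [0..<k]"

lemma length_shifts [simp]: "length (shifts k p) = k" by (simp add: shifts_def)

lemma sum_norm_shift_le:
  assumes "(\<Sum>c\<le>n. cmod (coeff p c)) \<le> L" "degree p \<le> n"
  shows "(\<Sum>c<N. cmod (coeff (monom 1 j * p) c)) \<le> L"
proof -
  have "(\<Sum>c<N. cmod (coeff (monom 1 j * p) c)) = (\<Sum>c\<in>{j..<N}. cmod (coeff p (c - j)))"
    by (rule sum.mono_neutral_cong_right) (auto simp: coeff_monom_mult)
  also have "\<dots> = (\<Sum>c<N - j. cmod (coeff p c))"
    by (rule sum.reindex_bij_witness[of _ "\<lambda>c. c + j" "\<lambda>c. c - j"]) auto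
  also have "\<dots> \<le> (\<Sum>c\<in>{..<N - j} \<union> {..n}. cmod (coeff p c))"
    by (rule sum_mono2) auto
  also have "\<dots> = (\<Sum>c\<le>n. cmod (coeff p c))"
    using assms(2) by (intro sum.mono_neutral_right) (auto simp: coeff_eq_0)
  finally show ?thesis using assms(1) by simp
qed

text \<open>This passes from degree \<open>n + k\<close> to degree \<open>n + k - 1\<close>. The two rows of highest shift are
  replaced by unit rows, each time at the cost of a factor \<open>L\<close>. The remaining shifted rows do not
  reach the last column; as the determinant is not zero, one of the unit rows must be the one of the
  last column, and expanding along it removes that row and that column.\<close>

lemma absdet_sylvester_step:
  assumes u: "(\<Sum>c\<le>n. cmod (coeff u c)) \<le> L" "degree u \<le> n"
    and w: "(\<Sum>c\<le>n. cmod (coeff w c)) \<le> L" "degree w \<le> n"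
    and len: "length cs = n - Suc k" and k: "k < n"
    and pos: "absdet (n + Suc k) (shifts (Suc k) u @ shifts (Suc k) w @ map (monom 1) cs) > 0"
  obtains cs' where "length cs' = n - k"
    "absdet (n + Suc k) (shifts (Suc k) u @ shifts (Suc k) w @ map (monom 1) cs)
       \<le> L ^ 2 * absdet (n + k) (shifts k u @ shifts k w @ map (monom 1) cs')"
proof -
  define S where "S = shifts k u @ shifts k w"
  define a where "a = monom 1 k * u"
  define b where "b = monom 1 k * w"
  define N where "N = n + k"
  have N: "length (S @ map (monom 1 :: nat \<Rightarrow> complex poly) cs) = N - 1" "N \<ge> 1"
    using len k by (auto simp: S_def N_def)
  have L: "L \<ge> 0" using u(1) by (rule order.trans[rotated]) (simp add: sum_nonneg)
  have rowa: "(\<Sum>c<Suc N. cmod (coeff a c)) \<le> L" and rowb: "(\<Sum>c<Suc N. cmod (coeff b c)) \<le> L"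
    unfolding a_def b_def by (rule sum_norm_shift_le[OF u] sum_norm_shift_le[OF w])+
  let ?R = "absdet (n + Suc k) (shifts (Suc k) u @ shifts (Suc k) w @ map (monom 1) cs)"
  have "?R = absdet (Suc N) (a # b # S @ map (monom 1) cs)"
    unfolding N_def add_Suc_right
    by (rule absdet_mset_cong) (use len k in \<open>auto simp: S_def a_def b_def shifts_def\<close>)
  also obtain c where "absdet (Suc N) (a # b # S @ map (monom 1) cs)
      \<le> L * absdet (Suc N) (monom 1 c # b # S @ map (monom 1) cs)"
    by (rule absdet_replace_row[of "b # S @ map (monom 1) cs" N a L, OF _ rowa]) (use N in auto)
  also have "absdet (Suc N) (monom 1 c # b # S @ map (monom 1) cs) =
      absdet (Suc N) (b # S @ map (monom 1) (c # cs))"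
    by (rule absdet_mset_cong) (use N in auto)
  also obtain c' where c': "absdet (Suc N) (b # S @ map (monom 1) (c # cs))
      \<le> L * absdet (Suc N) (monom 1 c' # S @ map (monom 1) (c # cs))"
    by (rule absdet_replace_row[of "S @ map (monom 1) (c # cs)" N b L, OF _ rowb]) (use N in auto)
  have "absdet (Suc N) (monom 1 c' # S @ map (monom 1) (c # cs)) =
      absdet (Suc N) (S @ map (monom 1) (c' # c # cs))"
    by (rule absdet_mset_cong) (use N in auto)
  note c' = c'[unfolded this]
  from c' have "L * absdet (Suc N) (b # S @ map (monom 1) (c # cs))
      \<le> L * (L * absdet (Suc N) (S @ map (monom 1) (c' # c # cs)))"
    by (rule mult_left_mono) (rule L)
  finally have le: "?R \<le> L\<^sup>2 * absdet (Suc N) (S @ map (monom 1) (c' # c # cs))"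
    by (simp add: power2_eq_square)
  define ds where "ds = c' # c # cs"
  from le pos have "absdet (Suc N) (S @ map (monom 1) ds) \<noteq> 0" by (auto simp: ds_def)
  moreover have "length (S @ map (monom 1 :: nat \<Rightarrow> complex poly) ds) = Suc N"
    using N by (auto simp: ds_def)
  ultimately obtain p where p: "p \<in> set (S @ map (monom 1) ds)" "coeff p N \<noteq> 0"
    using absdet_nonzero_col[of "Suc N" _ N] by blast
  \<comment> \<open>The shifted rows have degree below \<open>N\<close>, so the last column is served by a unit row.\<close>
  have "p \<notin> set S"
  proof
    assume "p \<in> set S"
    then obtain j q where "p = monom 1 j * q" "j < k" "q = u \<or> q = w"
      by (auto simp: S_def shifts_def)
    then have "coeff p N = 0" using u(2) w(2)
      by (auto simp: coeff_monom_mult N_def intro!: coeff_eq_0)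
    with p(2) show False by simp
  qed
  with p have "N \<in> set ds" by (auto split: if_splits)
  then have rem: "length (remove1 N ds) = Suc (length cs)"
    unfolding length_remove1 by (simp only: if_True) (simp add: ds_def)
  have "absdet (Suc N) (S @ map (monom 1) ds) = absdet (Suc N) (monom 1 N # S @ map (monom 1) (remove1 N ds))"
  proof (rule absdet_mset_cong)
    have "mset ds = mset (N # remove1 N ds)" using \<open>N \<in> set ds\<close> by simp
    then have "mset (map (monom 1) ds) = mset (map (monom 1 :: nat \<Rightarrow> complex poly) (N # remove1 N ds))"
      unfolding mset_map by (rule arg_cong)
    then show "mset (S @ map (monom 1) ds) = mset (monom 1 N # S @ map (monom 1) (remove1 N ds))"
      by simp
  qed (use N rem in auto)
  also have "\<dots> = absdet N (S @ map (monom 1) (remove1 N ds))"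
    by (rule absdet_drop_top_monom) (use N rem in auto)
  finally show thesis using le that[of "remove1 N ds"] rem len k
    by (simp add: ds_def[symmetric] S_def N_def)
qed

text \<open>The full Sylvester determinant in degree \<open>2 n - 1\<close> bounds from below the determinants in lower
  degree whose unit rows are chosen well. The unit rows play the part of the monomial forms.\<close>

lemma absdet_sylvester_minors:
  assumes u: "(\<Sum>c\<le>n. cmod (coeff u c)) \<le> L" "degree u \<le> n"
    and w: "(\<Sum>c\<le>n. cmod (coeff w c)) \<le> L" "degree w \<le> n"
    and pos: "absdet (2 * n) (shifts n u @ shifts n w) > 0" and k: "k \<le> n"
  obtains cs where "length cs = n - k"
    "absdet (2 * n) (shifts n u @ shifts n w)
       \<le> L ^ (2 * (n - k)) * absdet (n + k) (shifts k u @ shifts k w @ map (monom 1) cs)"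
proof -
  let ?R = "absdet (2 * n) (shifts n u @ shifts n w)"
  have L: "L \<ge> 0" using u(1) by (rule order.trans[rotated]) (simp add: sum_nonneg)
  have "\<exists>cs. length cs = n - k \<and> ?R \<le> L ^ (2 * (n - k)) *
      absdet (n + k) (shifts k u @ shifts k w @ map (monom 1) cs)"
    using k
  proof (induction rule: inc_induct)
    case base
    then show ?case by (intro exI[of _ "[]"]) (simp add: mult_2)
  next
    case (step k)
    then obtain cs where cs: "length cs = n - Suc k" and R: "?R \<le> L ^ (2 * (n - Suc k)) *
      absdet (n + Suc k) (shifts (Suc k) u @ shifts (Suc k) w @ map (monom 1) cs)" by blast
    have "absdet (n + Suc k) (shifts (Suc k) u @ shifts (Suc k) w @ map (monom 1) cs) > 0"
      using R pos L by (smt (verit) mult_nonneg_nonpos zero_le_power)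
    with absdet_sylvester_step[OF u w cs step(2)] obtain cs' where cs': "length cs' = n - k"
      "absdet (n + Suc k) (shifts (Suc k) u @ shifts (Suc k) w @ map (monom 1) cs)
       \<le> L ^ 2 * absdet (n + k) (shifts k u @ shifts k w @ map (monom 1) cs')" by blast
    note R
    also have "L ^ (2 * (n - Suc k)) *
        absdet (n + Suc k) (shifts (Suc k) u @ shifts (Suc k) w @ map (monom 1) cs)
      \<le> L ^ (2 * (n - Suc k)) * (L ^ 2 * absdet (n + k) (shifts k u @ shifts k w @ map (monom 1) cs'))"
      using cs'(2) L by (intro mult_left_mono) auto
    also have "\<dots> = L ^ (2 * (n - Suc k) + 2) * absdet (n + k) (shifts k u @ shifts k w @ map (monom 1) cs')"
      by (simp only: power_add mult.assoc)
    also have "2 * (n - Suc k) + 2 = 2 * (n - k)" using step(2) by simp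
    finally show ?case using cs'(1) by blast
  qed
  then show thesis using that by blast
qed

section \<open>The homogeneous Vandermonde determinant\<close>

text \<open>This is \<open>0\<close> exactly if \<open>p\<close> and \<open>q\<close> lie on a common line through the origin.\<close>

definition wedge :: "complex \<times> complex \<Rightarrow> complex \<times> complex \<Rightarrow> complex" where
  "wedge p q = fst p * snd q - snd p * fst q"

lemma norm_wedge_commute: "cmod (wedge p q) = cmod (wedge q p)"
  unfolding wedge_def by (subst norm_minus_commute) (simp add: mult.commute)

text \<open>Homogeneous coordinates are used because a zero line may be the line at infinity \<open>y = 0\<close>.\<close>

definition vandermonde_mat :: "nat \<Rightarrow> (nat \<Rightarrow> complex \<times> complex) \<Rightarrow> complex mat" where
  "vandermonde_mat m p = Matrix.mat m m (\<lambda>(k, c). fst (p c) ^ k * snd (p c) ^ (m - 1 - k))"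

lemma sum_lessThan_delta2:
  fixes g :: "nat \<Rightarrow> complex"
  assumes "i < N" "j < N" "i \<noteq> j"
  shows "(\<Sum>k<N. (if k = i then a else if k = j then b else 0) * g k) = a * g i + b * g j"
proof -
  have "(\<Sum>k<N. (if k = i then a else if k = j then b else 0) * g k)
    = (\<Sum>k<N. (if k = i then a * g i else 0) + (if k = j then b * g j else 0))"
    using assms by (intro sum.cong) auto
  also have "\<dots> = a * g i + b * g j" using assms by (simp add: sum.distrib)
  finally show ?thesis .
qed

text \<open>For \<open>r \<ge> 1\<close> the row of \<open>x\<^sup>r y\<^bsup>m-r\<^esup>\<close> is replaced by \<open>x\<^bsup>r-1\<^esup> y\<^bsup>m-r\<^esup>\<close> times the linear form that
  vanishes at \<open>p 0\<close>. This is a lower triangular row operation, and it clears the column of \<open>p 0\<close> up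
  to one entry. The operation is singular if \<open>p 0\<close> is at infinity, but then that column has a
  single nonzero entry from the start.\<close>

lemma det_vandermonde_Suc:
  "cmod (Determinant.det (vandermonde_mat (Suc m) p)) =
     (\<Prod>c<m. cmod (wedge (p 0) (p (Suc c)))) * cmod (Determinant.det (vandermonde_mat m (\<lambda>c. p (Suc c))))"
proof (cases "snd (p 0) = 0")
  case True
  let ?E = "vandermonde_mat (Suc m) p"
  have E: "?E \<in> carrier_mat (Suc m) (Suc m)" by (simp add: vandermonde_mat_def)
  have "Determinant.det ?E = (\<Sum>k<Suc m. if k = m then fst (p 0) ^ m * cofactor ?E m 0 else 0)"
    unfolding laplace_expansion_column[OF E zero_less_Suc]
    by (intro sum.cong refl) (auto simp: vandermonde_mat_def True power_0_left)
  then have det: "Determinant.det ?E = fst (p 0) ^ m * cofactor ?E m 0" by simp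
  have "mat_delete ?E m 0 = Matrix.mat m m (\<lambda>(k, c). 1 * snd (p (Suc c)) *
      (fst (p (Suc c)) ^ k * snd (p (Suc c)) ^ (m - 1 - k)))"
    unfolding mat_delete_def vandermonde_mat_def
    by (intro eq_matI) (auto simp: power_Suc[symmetric] Suc_diff_Suc simp del: power_Suc)
  then have del: "Determinant.det (mat_delete ?E m 0) = (\<Prod>c<m. snd (p (Suc c))) *
      Determinant.det (vandermonde_mat m (\<lambda>c. p (Suc c)))"
    by (simp only: det_scale) (simp add: vandermonde_mat_def)
  show ?thesis
    unfolding det cofactor_def del
    by (simp add: norm_mult norm_power prod_norm wedge_def True prod.distrib)
next
  case False
  let ?E = "vandermonde_mat (Suc m) p"
  define x where "x = fst (p 0)"
  define y where "y = snd (p 0)"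
  define F where "F = Matrix.mat (Suc m) (Suc m) (\<lambda>(r, k).
    if k = r then (if r = 0 then 1 else y) else if k = r - 1 then - x else 0)"
  have E: "?E \<in> carrier_mat (Suc m) (Suc m)" by (simp add: vandermonde_mat_def)
  have F: "F \<in> carrier_mat (Suc m) (Suc m)" by (simp add: F_def)
  have "Determinant.det F = prod_list (diag_mat F)"
    by (rule det_lower_triangular[OF _ F]) (auto simp: F_def)
  also have "diag_mat F = map (\<lambda>r. if r = 0 then 1 else y) [0..<Suc m]"
    unfolding diag_mat_def by (intro map_cong) (auto simp: F_def)
  also have "prod_list \<dots> = (\<Prod>r<Suc m. if r = 0 then 1 else y)"
    by (subst prod.distinct_set_conv_list[symmetric]) (auto simp: lessThan_atLeast0 simp del: upt_Suc)
  also have "\<dots> = y ^ m" by (subst prod.lessThan_Suc_shift) simp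
  finally have detF: "Determinant.det F = y ^ m" .
  have FE: "F * ?E = Matrix.mat (Suc m) (Suc m) (\<lambda>(r, c). if r = 0 then snd (p c) ^ m
    else wedge (p c) (p 0) * (fst (p c) ^ (r - 1) * snd (p c) ^ (m - r)))" (is "_ = ?G")
  proof (rule eq_matI)
    fix r c assume "r < dim_row ?G" "c < dim_col ?G"
    then have rc: "r < Suc m" "c < Suc m" by auto
    have *: "(F * ?E) $$ (r, c) = (\<Sum>k<Suc m. F $$ (r, k) * (fst (p c) ^ k * snd (p c) ^ (m - k)))"
      using rc by (simp add: times_mat_def scalar_prod_def F_def vandermonde_mat_def lessThan_atLeast0)
    show "(F * ?E) $$ (r, c) = ?G $$ (r, c)"
    proof (cases r)
      case 0
      have "(F * ?E) $$ (r, c) = (\<Sum>k<Suc m. if k = 0 then snd (p c) ^ m else 0)"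
        unfolding * using rc by (intro sum.cong) (auto simp: F_def 0)
      then show ?thesis using rc 0 by simp
    next
      case (Suc s)
      have "(F * ?E) $$ (r, c) = (\<Sum>k<Suc m. (if k = r then y else if k = s then - x else 0) *
          (fst (p c) ^ k * snd (p c) ^ (m - k)))"
        unfolding * using rc by (intro sum.cong) (auto simp: F_def Suc)
      also have "\<dots> = y * (fst (p c) ^ r * snd (p c) ^ (m - r)) + - x * (fst (p c) ^ s * snd (p c) ^ (m - s))"
        by (rule sum_lessThan_delta2) (use rc Suc in auto)
      also have "m - s = Suc (m - r)" using rc Suc by auto
      finally show ?thesis using rc Suc
        by (simp add: wedge_def x_def y_def algebra_simps)
    qed
  qed (auto simp: F_def vandermonde_mat_def)
  have G: "?G \<in> carrier_mat (Suc m) (Suc m)" by simp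
  have "Determinant.det ?G = (\<Sum>k<Suc m. if k = 0 then y ^ m * cofactor ?G 0 0 else 0)"
    unfolding laplace_expansion_column[OF G zero_less_Suc]
    by (intro sum.cong refl) (auto simp: wedge_def y_def)
  then have det: "Determinant.det ?G = y ^ m * cofactor ?G 0 0" by simp
  have "mat_delete ?G 0 0 = Matrix.mat m m (\<lambda>(k, c). 1 * wedge (p (Suc c)) (p 0) *
      (fst (p (Suc c)) ^ k * snd (p (Suc c)) ^ (m - 1 - k)))"
    unfolding mat_delete_def by (intro eq_matI) auto
  then have del: "Determinant.det (mat_delete ?G 0 0) = (\<Prod>c<m. wedge (p (Suc c)) (p 0)) *
      Determinant.det (vandermonde_mat m (\<lambda>c. p (Suc c)))"
    by (simp only: det_scale) (simp add: vandermonde_mat_def)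
  have "y ^ m * Determinant.det ?E = y ^ m * ((\<Prod>c<m. wedge (p (Suc c)) (p 0)) *
      Determinant.det (vandermonde_mat m (\<lambda>c. p (Suc c))))"
    using det_mult[OF F E, symmetric] unfolding detF FE det cofactor_def del by simp
  then have "Determinant.det ?E = (\<Prod>c<m. wedge (p (Suc c)) (p 0)) *
      Determinant.det (vandermonde_mat m (\<lambda>c. p (Suc c)))"
    using False by (simp add: y_def)
  moreover have "cmod (wedge (p (Suc c)) (p 0)) = cmod (wedge (p 0) (p (Suc c)))" for c
    unfolding wedge_def by (subst norm_minus_commute) (simp add: mult.commute)
  ultimately show ?thesis by (simp add: norm_mult prod_norm[symmetric])
qed

lemma norm_det_vandermonde:
  "cmod (Determinant.det (vandermonde_mat m p)) = (\<Prod>j<m. \<Prod>i<j. cmod (wedge (p i) (p j)))"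
proof (induction m arbitrary: p)
  case 0
  have "Determinant.det (vandermonde_mat 0 p) = 1"
    by (rule det_dim_zero) (simp add: vandermonde_mat_def)
  then show ?case by simp
next
  case (Suc m)
  show ?case
    unfolding det_vandermonde_Suc Suc.IH
    by (subst prod.lessThan_Suc_shift) (simp add: prod.lessThan_Suc_shift prod.distrib del: prod.lessThan_Suc)
qed

section \<open>Evaluation at points of the projective line\<close>

text \<open>The value at \<open>z\<close> of the form of degree \<open>m\<close> whose value at \<open>y = 1\<close> is \<open>p\<close>.\<close>

definition hom_eval :: "nat \<Rightarrow> complex poly \<Rightarrow> complex \<times> complex \<Rightarrow> complex" where
  "hom_eval m p z = (\<Sum>k\<le>m. coeff p k * (fst z ^ k * snd z ^ (m - k)))"

lemma hom_eval_affine: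
  assumes "degree p \<le> m" "snd z \<noteq> 0"
  shows "hom_eval m p z = snd z ^ m * poly p (fst z / snd z)"
proof -
  have "poly p (fst z / snd z) = (\<Sum>k\<le>m. coeff p k * (fst z / snd z) ^ k)"
    unfolding poly_altdef using assms(1) by (intro sum.mono_neutral_left) (auto simp: coeff_eq_0)
  then show ?thesis
    using assms(2) by (simp add: hom_eval_def sum_distrib_left power_divide power_diff mult_ac)
qed

lemma hom_eval_infinity:
  assumes "snd z = 0"
  shows "hom_eval m p z = coeff p m * fst z ^ m"
proof -
  have "hom_eval m p z = (\<Sum>k\<le>m. if k = m then coeff p m * fst z ^ m else 0)"
    unfolding hom_eval_def by (intro sum.cong) (auto simp: assms power_0_left)
  then show ?thesis by simp
qed

text \<open>Off the line at infinity, \<open>hom_eval\<close> is a power of \<open>y\<close> times the value of the polynomial at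
  \<open>x / y\<close>; at infinity it is the top coefficient times a power of \<open>x\<close>. Both are multiplicative.\<close>

lemma hom_eval_mult:
  assumes "degree p \<le> a" "degree q \<le> b"
  shows "hom_eval (a + b) (p * q) z = hom_eval a p z * hom_eval b q z"
proof (cases "snd z = 0")
  case True
  have "coeff (p * q) (a + b) = (\<Sum>i\<le>a + b. if i = a then coeff p a * coeff q b else 0)"
    unfolding coeff_mult
  proof (intro sum.cong refl)
    fix i assume "i \<in> {..a + b}"
    consider "i < a" | "i = a" | "i > a" by linarith
    then show "coeff p i * coeff q (a + b - i) = (if i = a then coeff p a * coeff q b else 0)"
      by cases (use assms in \<open>auto simp: coeff_eq_0\<close>)
  qed
  then show ?thesis by (simp add: hom_eval_infinity[OF True] power_add)
next
  case False
  have "degree (p * q) \<le> a + b" using assms degree_mult_le[of p q] by linarith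
  then show ?thesis using assms False by (simp add: hom_eval_affine power_add)
qed

lemma hom_eval_add: "hom_eval m (p + q) z = hom_eval m p z + hom_eval m q z"
  by (simp add: hom_eval_def algebra_simps sum.distrib)

lemma hom_eval_smult: "hom_eval m (Polynomial.smult c p) z = c * hom_eval m p z"
  by (simp add: hom_eval_def sum_distrib_left mult_ac)

lemma hom_eval_monom: "j \<le> m \<Longrightarrow> hom_eval m (monom 1 j) z = fst z ^ j * snd z ^ (m - j)"
  unfolding hom_eval_def by (subst sum.remove[of _ j]) (auto intro!: sum.neutral)

lemma hom_eval_shift:
  assumes "degree p \<le> d" "j + d \<le> m"
  shows "hom_eval m (monom 1 j * p) z = fst z ^ j * snd z ^ (m - d - j) * hom_eval d p z"
proof -
  have "hom_eval ((m - d) + d) (monom 1 j * p) z = hom_eval (m - d) (monom 1 j) z * hom_eval d p z"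
    by (rule hom_eval_mult) (use assms in \<open>auto simp: degree_monom_eq\<close>)
  then show ?thesis using assms by (simp add: hom_eval_monom)
qed

text \<open>Multiplying the coefficient matrix by a Vandermonde matrix evaluates all rows at all points.\<close>

lemma absdet_times_vandermonde:
  assumes "N > 0"
  shows "absdet N ps * cmod (Determinant.det (vandermonde_mat N p)) =
    cmod (Determinant.det (Matrix.mat N N (\<lambda>(i, c). hom_eval (N - 1) (ps ! i) (p c))))"
proof -
  let ?A = "Matrix.mat N N (\<lambda>(i, k). coeff (ps ! i) k)"
  have "{0..<N} = {..N - 1}" using assms by auto
  then have "?A * vandermonde_mat N p = Matrix.mat N N (\<lambda>(i, c). hom_eval (N - 1) (ps ! i) (p c))"
    by (intro eq_matI) (auto simp: times_mat_def scalar_prod_def vandermonde_mat_def hom_eval_def)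
  moreover have "Determinant.det (?A * vandermonde_mat N p) = Determinant.det ?A * Determinant.det (vandermonde_mat N p)"
    by (rule det_mult) (auto simp: vandermonde_mat_def)
  ultimately show ?thesis by (simp add: absdet_def norm_mult)
qed

section \<open>The resultant of the partial derivatives and the discriminant\<close>

text \<open>The linear form \<open>linear2 v\<close> at \<open>y = 1\<close>.\<close>

definition lin :: "complex \<times> complex \<Rightarrow> complex poly" where
  "lin v = [:snd v, fst v:]"

definition zero_of :: "complex \<times> complex \<Rightarrow> complex \<times> complex" where
  "zero_of v = (snd v, - fst v)"

text \<open>If \<open>f\<close> is \<open>h(x, 1)\<close> for a form \<open>h\<close> of degree \<open>m\<close>, then \<open>pderiv f\<close> is \<open>\<partial>h/\<partial>x\<close> at \<open>y = 1\<close>,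
  and by Euler's identity \<open>x \<partial>h/\<partial>x + y \<partial>h/\<partial>y = m h\<close> this is \<open>\<partial>h/\<partial>y\<close> at \<open>y = 1\<close>.\<close>

definition dual_deriv :: "nat \<Rightarrow> complex poly \<Rightarrow> complex poly" where
  "dual_deriv m f = Polynomial.smult (of_nat m) f - monom 1 1 * pderiv f"

lemma degree_lin: "degree (lin v) \<le> 1" by (simp add: lin_def)

lemma hom_eval_lin: "hom_eval 1 (lin v) z = fst v * fst z + snd v * snd z"
  by (simp add: hom_eval_def lin_def)

lemma degree_prod_lin_le: "finite I \<Longrightarrow> degree (\<Prod>i\<in>I. lin (v i)) \<le> card I"
proof (induction I rule: finite_induct)
  case (insert i I)
  then show ?case using degree_mult_le[of "lin (v i)" "\<Prod>i\<in>I. lin (v i)"] degree_lin[of "v i"] by simp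
qed simp

lemma hom_eval_prod_lin:
  "finite I \<Longrightarrow> hom_eval (card I) (\<Prod>i\<in>I. lin (v i)) z = (\<Prod>i\<in>I. fst (v i) * fst z + snd (v i) * snd z)"
proof (induction I rule: finite_induct)
  case empty
  show ?case by (simp add: hom_eval_def)
next
  case (insert i I)
  then show ?case
    using hom_eval_mult[OF degree_lin[of "v i"] degree_prod_lin_le[of I v], of z]
    by (simp add: hom_eval_lin[unfolded One_nat_def])
qed

lemma coeff_dual_deriv: "coeff (dual_deriv m f) k = (of_nat m - of_nat k) * coeff f k"
  by (cases k) (simp_all add: dual_deriv_def coeff_monom_mult coeff_pderiv left_diff_distrib distrib_right)

lemma degree_dual_deriv_le:
  assumes "degree f \<le> Suc m"
  shows "degree (dual_deriv (Suc m) f) \<le> m"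
proof (rule degree_le, intro allI impI)
  fix k assume "m < k"
  then consider "k = Suc m" | "k > degree f" using assms by linarith
  then show "coeff (dual_deriv (Suc m) f) k = 0"
    by cases (auto simp: coeff_dual_deriv coeff_eq_0)
qed

lemma degree_pderiv_le_pred: "degree (f :: complex poly) \<le> Suc m \<Longrightarrow> degree (pderiv f) \<le> m"
  by (simp add: degree_pderiv)

lemma euler_dual_deriv: "monom 1 1 * pderiv f + dual_deriv m f = Polynomial.smult (of_nat m) f"
  by (simp add: dual_deriv_def)

text \<open>At a zero of the factor \<open>lin v\<close> the gradient of \<open>lin v * g\<close> is the gradient of \<open>lin v\<close> times the
  value of \<open>g\<close>.\<close>

lemma hom_eval_derivs_at_zero:
  assumes "degree g \<le> Suc m"
  shows "hom_eval (Suc m) (pderiv (lin v * g)) (zero_of v) = fst v * hom_eval (Suc m) g (zero_of v)"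
    and "hom_eval (Suc m) (dual_deriv (Suc (Suc m)) (lin v * g)) (zero_of v)
       = snd v * hom_eval (Suc m) g (zero_of v)"
proof -
  have z: "hom_eval 1 (lin v) (zero_of v) = 0"
    by (simp add: hom_eval_lin[unfolded One_nat_def] zero_of_def)
  have "pderiv (lin v) = [:fst v:]" by (simp add: lin_def pderiv_pCons)
  then have 1: "pderiv (lin v * g) = lin v * pderiv g + Polynomial.smult (fst v) g"
    by (simp add: pderiv_mult \<open>pderiv (lin v) = [:fst v:]\<close>)
  have "lin v = [:fst v:] * monom 1 1 + [:snd v:]" by (simp add: lin_def monom_altdef)
  moreover have "(c + 1) * (L * g) - X * (L * g' + A * g) = L * (c * g - X * g') + B * g"
    if "L = A * X + B" for A B L X g g' c :: "complex poly"
    unfolding that by (simp add: algebra_simps)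
  ultimately have "([:of_nat (Suc m):] + 1) * (lin v * g) - monom 1 1 * (lin v * pderiv g + [:fst v:] * g)
    = lin v * ([:of_nat (Suc m):] * g - monom 1 1 * pderiv g) + [:snd v:] * g" by blast
  moreover have "[:of_nat (Suc m):] + 1 = [:of_nat (Suc (Suc m)) :: complex:]"
    by (simp add: one_pCons)
  ultimately have 2: "dual_deriv (Suc (Suc m)) (lin v * g)
      = lin v * dual_deriv (Suc m) g + Polynomial.smult (snd v) g"
    unfolding dual_deriv_def 1 by simp
  have vanish: "hom_eval (Suc m) (lin v * q) (zero_of v) = 0" if "degree q \<le> m" for q
    using hom_eval_mult[OF degree_lin that, of v "zero_of v"] z by simp
  show "hom_eval (Suc m) (pderiv (lin v * g)) (zero_of v) = fst v * hom_eval (Suc m) g (zero_of v)"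
    unfolding 1 hom_eval_add hom_eval_smult using vanish degree_pderiv_le_pred[OF assms] by simp
  show "hom_eval (Suc m) (dual_deriv (Suc (Suc m)) (lin v * g)) (zero_of v)
       = snd v * hom_eval (Suc m) g (zero_of v)"
    unfolding 2 hom_eval_add hom_eval_smult using vanish degree_dual_deriv_le[OF assms] by simp
qed

lemma wedge_zero_of: "wedge (zero_of v) (zero_of w) = wedge v w"
  by (simp add: wedge_def zero_of_def algebra_simps)

text \<open>Each unordered pair occurs twice on the left.\<close>

lemma prod_offdiag:
  fixes g :: "nat \<Rightarrow> nat \<Rightarrow> real"
  assumes sym: "\<And>i j. g i j = g j i"
  shows "(\<Prod>j<n. \<Prod>i\<in>{..<n} - {j}. g i j) = (\<Prod>j<n. \<Prod>i<j. g i j) ^ 2"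
proof (induction n)
  case (Suc n)
  have "(\<Prod>j<n. \<Prod>i\<in>{..<Suc n} - {j}. g i j) = (\<Prod>j<n. g n j * (\<Prod>i\<in>{..<n} - {j}. g i j))"
  proof (intro prod.cong refl)
    fix j assume "j \<in> {..<n}"
    then have "{..<Suc n} - {j} = insert n ({..<n} - {j})" by auto
    then show "(\<Prod>i\<in>{..<Suc n} - {j}. g i j) = g n j * (\<Prod>i\<in>{..<n} - {j}. g i j)" by simp
  qed
  also have "\<dots> = (\<Prod>i<n. g i n) * (\<Prod>j<n. \<Prod>i<j. g i j) ^ 2"
    by (simp add: prod.distrib Suc sym[of n])
  finally show ?case
    by (simp add: lessThan_Suc power2_eq_square algebra_simps)
qed simp

text \<open>The points \<open>(t, 1)\<close> with \<open>t\<close> outside a finite set.\<close>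

lemma ex_auxiliary_points:
  fixes p :: "nat \<Rightarrow> complex \<times> complex"
  assumes "\<forall>i<K. p i \<noteq> 0"
  shows "\<exists>q :: nat \<Rightarrow> complex \<times> complex. (\<forall>i<K. \<forall>j. wedge (p i) (q j) \<noteq> 0) \<and> (\<forall>i j. i \<noteq> j \<longrightarrow> wedge (q i) (q j) \<noteq> 0)"
proof -
  let ?B = "(\<lambda>i. fst (p i) / snd (p i)) ` {..<K}"
  have "infinite (UNIV - ?B)" by (simp add: infinite_UNIV_char_0)
  then obtain t :: "nat \<Rightarrow> complex" where t: "inj t" "range t \<subseteq> UNIV - ?B"
    using infinite_countable_subset by blast
  have "wedge (p i) (t j, 1) \<noteq> 0" if "i < K" for i j
  proof
    assume *: "wedge (p i) (t j, 1) = 0"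
    then have "snd (p i) \<noteq> 0" using assms that by (auto simp: wedge_def prod_eq_iff)
    with * have "t j = fst (p i) / snd (p i)" by (simp add: wedge_def field_simps)
    with t(2) that show False by blast
  qed
  moreover have "wedge (t i, 1) (t j, 1) \<noteq> 0" if "i \<noteq> j" for i j
    using that t(1) by (auto simp: wedge_def inj_eq)
  ultimately show ?thesis by (intro exI[of _ "\<lambda>j. (t j, 1)"]) blast
qed

text \<open>Let \<open>h\<close> be the form of degree \<open>n + 1\<close> whose value at \<open>y = 1\<close> is \<open>f\<close>. By Euler's identity, adding to the row \<open>x\<^bsup>j\<^esup> y\<^bsup>n-1-j\<^esup> \<partial>h/\<partial>x\<close>, \<open>j \<ge> 1\<close>, the row
  \<open>x\<^bsup>j-1\<^esup> y\<^bsup>n-j\<^esup> \<partial>h/\<partial>y\<close> turns it into a multiple of \<open>h\<close>, which vanishes at all zeros of \<open>h\<close>.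
  With the row \<open>y\<^bsup>n-1\<^esup> \<partial>h/\<partial>x\<close> put first these additions are unipotent and lower triangular.\<close>

lemma absdet_sylvester_euler:
  fixes f :: "complex poly"
  assumes "degree f \<le> m + 2"
  defines "n \<equiv> Suc m"
  defines "w \<equiv> pderiv f" and "u \<equiv> dual_deriv (n + 1) f"
  defines "rs \<equiv> \<lambda>r. if r = 0 then w else if r \<le> n then monom 1 (r - 1) * u
    else Polynomial.smult (of_nat (n + 1)) (monom 1 (r - n - 1) * f)"
  shows "absdet (2 * n) (shifts n u @ shifts n w) = absdet (2 * n) (map rs [0..<2 * n])"
proof -
  define ps where "ps = w # shifts n u @ map (\<lambda>j. monom 1 (Suc j) * w) [0..<m]"
  have "shifts n w = w # map (\<lambda>j. monom 1 (Suc j) * w) [0..<m]"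
    unfolding shifts_def n_def upt_conv_Cons[OF zero_less_Suc] map_Suc_upt[symmetric]
    by (simp add: monom_0 one_pCons[symmetric] comp_def)
  then have R: "absdet (2 * n) (shifts n u @ shifts n w) = absdet (2 * n) ps"
    by (intro absdet_mset_cong) (auto simp: ps_def n_def)
  define A where "A = Matrix.mat (2 * n) (2 * n) (\<lambda>(i, k). coeff (ps ! i) k)"
  define U :: "complex mat" where "U = Matrix.mat (2 * n) (2 * n) (\<lambda>(r, k).
    if k = r then 1 else if k = r - n then (if r > n then 1 else 0) else 0)"
  have U: "U \<in> carrier_mat (2 * n) (2 * n)" and A: "A \<in> carrier_mat (2 * n) (2 * n)"
    by (simp_all add: U_def A_def)
  have "Determinant.det U = prod_list (diag_mat U)"
    by (rule det_lower_triangular[OF _ U]) (auto simp: U_def)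
  also have "diag_mat U = map (\<lambda>_. 1) [0..<2 * n]"
    unfolding diag_mat_def by (intro map_cong) (auto simp: U_def)
  finally have detU: "Determinant.det U = 1" by (simp add: map_replicate_const)
  have row: "rs r = ps ! r + (if r > n then ps ! (r - n) else 0)" if "r < 2 * n" for r
  proof -
    consider "r = 0" | "0 < r" "r \<le> n" | "r > n" by linarith
    then show ?thesis
    proof cases
      case 3
      have 1: "ps ! r = monom 1 (r - n) * w" and 2: "ps ! (r - n) = monom 1 (r - n - 1) * u"
        using 3 that by (auto simp: ps_def nth_Cons' nth_append shifts_def n_def Suc_diff_Suc)
      have "monom 1 (r - n) = monom 1 (r - n - 1) * monom (1 :: complex) 1"
        using 3 by (simp add: mult_monom Suc_diff_Suc)
      then have "ps ! r + ps ! (r - n) = monom 1 (r - n - 1) * (monom 1 1 * w + u)"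
        unfolding 1 2 by (simp add: algebra_simps)
      then show ?thesis using 3 unfolding w_def u_def euler_dual_deriv by (simp add: rs_def)
    qed (auto simp: rs_def ps_def nth_Cons' nth_append shifts_def)
  qed
  have "U * A = Matrix.mat (2 * n) (2 * n) (\<lambda>(i, k). coeff (map rs [0..<2 * n] ! i) k)"
  proof (intro eq_matI)
    fix r c assume "r < dim_row (Matrix.mat (2 * n) (2 * n) (\<lambda>(i, k). coeff (map rs [0..<2 * n] ! i) k))"
      and "c < dim_col (Matrix.mat (2 * n) (2 * n) (\<lambda>(i, k). coeff (map rs [0..<2 * n] ! i) k))"
    then have rc: "r < 2 * n" "c < 2 * n" by auto
    have "(U * A) $$ (r, c) = (\<Sum>k<2 * n. (if k = r then 1 else if k = r - n then (if r > n then 1 else 0) else 0) *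
        coeff (ps ! k) c)"
      using rc by (simp add: times_mat_def scalar_prod_def A_def U_def lessThan_atLeast0)
    also have "\<dots> = coeff (rs r) c"
    proof (cases "r = 0")
      case True
      then have "(\<Sum>k<2 * n. (if k = r then 1 else if k = r - n then (if r > n then 1 else 0) else 0) *
        coeff (ps ! k) c) = (\<Sum>k<2 * n. if k = r then coeff (ps ! r) c else 0)"
        by (intro sum.cong) auto
      then show ?thesis using row[OF rc(1)] rc True by simp
    next
      case False
      then show ?thesis
        using sum_lessThan_delta2[of r "2 * n" "r - n" 1 "if r > n then 1 else 0" "\<lambda>k. coeff (ps ! k) c"]
          row[OF rc(1)] rc by (simp add: n_def)
    qed
    finally show "(U * A) $$ (r, c) = Matrix.mat (2 * n) (2 * n) (\<lambda>(i, k). coeff (map rs [0..<2 * n] ! i) k) $$ (r, c)"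
      using rc by simp
  qed (auto simp: U_def A_def)
  then have "absdet (2 * n) (map rs [0..<2 * n]) = cmod (Determinant.det (U * A))"
    by (simp only: absdet_def)
  also have "\<dots> = absdet (2 * n) ps"
    unfolding det_mult[OF U A] detU by (simp add: A_def absdet_def)
  finally show ?thesis using R by simp
qed

text \<open>This is the classical identity between the resultant of \<open>\<partial>h/\<partial>x\<close>, \<open>\<partial>h/\<partial>y\<close> and the discriminant
  of \<open>h\<close>, up to sign. The rows given by Euler's identity are evaluated at the \<open>n + 1\<close> zeros
  of \<open>h\<close> and at \<open>n - 1\<close> further points. The multiples of \<open>h\<close> vanish at the zeros, so the matrix of
  values is block triangular; by the formula for the gradient at a zero, both diagonal blocks are
  Vandermonde matrices with scaled rows and columns. The Vandermonde determinants of all points and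
  of the two groups of points then cancel, up to the mixed factors; these cancel the values of \<open>h\<close> at
  the further points. What remains is the product over the zeros of the factors of the gradient.\<close>

theorem absdet_sylvester_partials:
  fixes v :: "nat \<Rightarrow> complex \<times> complex"
  assumes n: "n \<ge> 1" and distinct: "\<And>i j. i < j \<Longrightarrow> j \<le> n \<Longrightarrow> wedge (v i) (v j) \<noteq> 0"
  defines "f \<equiv> \<Prod>i\<le>n. lin (v i)"
  shows "absdet (2 * n) (shifts n (dual_deriv (n + 1) f) @ shifts n (pderiv f))
    = real (n + 1) ^ (n - 1) * (\<Prod>j\<le>n. \<Prod>i<j. cmod (wedge (v i) (v j))) ^ 2"
proof -
  obtain m where m: "n = Suc m" using n by (cases n) auto
  define K where "K = Suc n"
  have le_K: "{..n} = {..<K}" by (auto simp: K_def)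
  define p where "p i = zero_of (v i)" for i
  define w where "w = pderiv f"
  define u where "u = dual_deriv (n + 1) f"
  define W where "W x y = cmod (wedge x y)" for x y
  have ne: "wedge (v i) (v j) \<noteq> 0" if "i \<le> n" "j \<le> n" "i \<noteq> j" for i j
    using that distinct[of i j] distinct[of j i] norm_wedge_commute[of "v i" "v j"]
    by (metis linorder_neqE_nat norm_eq_zero)
  have p_nz: "p i \<noteq> 0" if "i < K" for i
  proof
    assume "p i = 0"
    then have "v i = 0" by (auto simp: p_def zero_of_def prod_eq_iff)
    then show False using ne[of i 0] ne[of 0 1] that n by (cases "i = 0") (auto simp: K_def wedge_def)
  qed
  obtain q :: "nat \<Rightarrow> complex \<times> complex" where
    "(\<forall>i<K. \<forall>j. wedge (p i) (q j) \<noteq> 0) \<and> (\<forall>i j. i \<noteq> j \<longrightarrow> wedge (q i) (q j) \<noteq> 0)"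
    using ex_auxiliary_points[of K p] p_nz by blast
  then have q: "\<And>i j. i < K \<Longrightarrow> wedge (p i) (q j) \<noteq> 0" "\<And>i j. i \<noteq> j \<Longrightarrow> wedge (q i) (q j) \<noteq> 0"
    by auto
  define pt where "pt c = (if c < K then p c else q (c - K))" for c
  define g where "g c = (\<Prod>j\<in>{..n} - {c}. lin (v j))" for c
  define H where "H c = hom_eval n (g c) (p c)" for c
  define F where "F c = hom_eval (n + 1) f (q c)" for c
  have f: "f = lin (v c) * g c" if "c \<le> n" for c
    unfolding f_def g_def using that by (intro prod.remove) auto
  have degg: "degree (g c) \<le> n" if "c \<le> n" for c
    unfolding g_def using degree_prod_lin_le[of "{..n} - {c}" v] that by simp
  have degf: "degree f \<le> n + 1"
    unfolding f_def using degree_prod_lin_le[of "{..n}" v] by simp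
  have degw: "degree w \<le> n" unfolding w_def using degf by (intro degree_pderiv_le_pred) simp
  have degu: "degree u \<le> n" unfolding u_def using degf degree_dual_deriv_le[of f n] by simp
  have evw: "hom_eval n w (p c) = fst (v c) * H c" if "c \<le> n" for c
    using hom_eval_derivs_at_zero(1)[of "g c" m "v c"] degg[OF that] f[OF that] m
    by (simp add: w_def H_def p_def)
  have evu: "hom_eval n u (p c) = snd (v c) * H c" if "c \<le> n" for c
    using hom_eval_derivs_at_zero(2)[of "g c" m "v c"] degg[OF that] f[OF that] m
    by (simp add: u_def H_def p_def)
  have evf: "hom_eval (n + 1) f z = (\<Prod>i\<le>n. fst (v i) * fst z + snd (v i) * snd z)" for z
    unfolding f_def using hom_eval_prod_lin[of "{..n}" v z] by simp
  have evf0: "hom_eval (n + 1) f (p c) = 0" if "c \<le> n" for c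
    unfolding evf using that by (auto simp: p_def zero_of_def intro!: bexI[of _ c])
  have normF: "cmod (F j) = (\<Prod>i<K. W (p i) (q j))" for j
    unfolding F_def evf le_K
    by (simp add: prod_norm[symmetric] W_def p_def zero_of_def wedge_def add.commute)
  have normH: "cmod (H c) = (\<Prod>i\<in>{..<K} - {c}. W (v i) (v c))" if "c < K" for c
  proof -
    have "H c = (\<Prod>i\<in>{..n} - {c}. fst (v i) * fst (p c) + snd (v i) * snd (p c))"
      unfolding H_def g_def using hom_eval_prod_lin[of "{..n} - {c}" v "p c"] that by (simp add: K_def)
    then show ?thesis
      unfolding le_K by (simp add: prod_norm[symmetric] W_def p_def zero_of_def wedge_def)
  qed
  \<comment> \<open>The order of the rows makes the upper left block below a row-scaled Vandermonde matrix
    without a permutation: its row \<open>r\<close> is \<open>\<plusminus>x\<^sup>r y\<^bsup>n-r\<^esup>\<close> times a column factor.\<close>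
  define rs where "rs = (\<lambda>r. if r = 0 then w else if r \<le> n then monom 1 (r - 1) * u
    else Polynomial.smult (of_nat (n + 1)) (monom 1 (r - n - 1) * f))"
  define R where "R = absdet (2 * n) (shifts n u @ shifts n w)"
  have R: "R = absdet (2 * n) (map rs [0..<2 * n])"
    using absdet_sylvester_euler[of f m] degf unfolding R_def rs_def u_def w_def m by simp
  define B1 where "B1 = Matrix.mat K K (\<lambda>(r, c). (if r = 0 then - 1 else 1) * H c *
    (fst (p c) ^ r * snd (p c) ^ (K - 1 - r)))"
  define B2 where "B2 = Matrix.mat K m (\<lambda>(r, c). hom_eval (2 * n - 1) (rs r) (q c))"
  define B4 where "B4 = Matrix.mat m m (\<lambda>(r, c). of_nat (n + 1) * F c *
    (fst (q c) ^ r * snd (q c) ^ (m - 1 - r)))"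
  have dim: "2 * n = K + m" by (simp add: K_def m)
  have "Matrix.mat (2 * n) (2 * n) (\<lambda>(r, c). hom_eval (2 * n - 1) (rs r) (pt c))
    = four_block_mat B1 B2 (0\<^sub>m m K) B4"
  proof (intro eq_matI)
    fix r c assume "r < dim_row (four_block_mat B1 B2 (0\<^sub>m m K) B4)"
      "c < dim_col (four_block_mat B1 B2 (0\<^sub>m m K) B4)"
    then have rc: "r < 2 * n" "c < 2 * n" by (auto simp: B1_def B4_def dim)
    have low: "hom_eval (2 * n - 1) (rs r) z = of_nat (n + 1) *
        (fst z ^ (r - K) * snd z ^ (m - 1 - (r - K)) * hom_eval (n + 1) f z)" if "r \<ge> K" for z
    proof -
      have "hom_eval (2 * n - 1) (monom 1 (r - n - 1) * f) z
        = fst z ^ (r - n - 1) * snd z ^ (2 * n - 1 - (n + 1) - (r - n - 1)) * hom_eval (n + 1) f z"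
        by (rule hom_eval_shift[OF degf]) (use that rc in \<open>auto simp: K_def\<close>)
      moreover have "2 * n - 1 - (n + 1) - (r - n - 1) = m - 1 - (r - K)" "r - n - 1 = r - K"
        using that rc by (auto simp: K_def m)
      ultimately show ?thesis using that by (simp add: rs_def hom_eval_smult K_def)
    qed
    have high: "hom_eval (2 * n - 1) (rs r) (p c) = (if r = 0 then - 1 else 1) * H c *
        (fst (p c) ^ r * snd (p c) ^ (K - 1 - r))" if "r < K" "c < K"
    proof (cases "r = 0")
      case True
      have "hom_eval (2 * n - 1) (monom 1 0 * w) (p c)
        = fst (p c) ^ 0 * snd (p c) ^ (2 * n - 1 - n - 0) * hom_eval n w (p c)"
        by (rule hom_eval_shift[OF degw]) (use n in auto)
      moreover have "fst (v c) = - snd (p c)" by (simp add: p_def zero_of_def)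
      moreover have "2 * n - 1 - n = m" by (simp add: m)
      ultimately show ?thesis
        using True that evw[of c] by (simp add: rs_def monom_0 one_pCons[symmetric] K_def m)
    next
      case False
      have "hom_eval (2 * n - 1) (monom 1 (r - 1) * u) (p c)
        = fst (p c) ^ (r - 1) * snd (p c) ^ (2 * n - 1 - n - (r - 1)) * hom_eval n u (p c)"
        by (rule hom_eval_shift[OF degu]) (use that False n in \<open>auto simp: K_def\<close>)
      moreover have "snd (v c) = fst (p c)" by (simp add: p_def zero_of_def)
      moreover have "2 * n - 1 - n - (r - 1) = K - 1 - r" using that False by (simp add: m K_def)
      moreover have "fst (p c) ^ r = fst (p c) ^ (r - 1) * fst (p c)" using False by (cases r) auto
      ultimately show ?thesis
        using False that evu[of c] by (simp add: rs_def K_def)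
    qed
    have "hom_eval (2 * n - 1) (rs r) (pt c) = four_block_mat B1 B2 (0\<^sub>m m K) B4 $$ (r, c)"
    proof (cases "r < K")
      case True
      then show ?thesis using high rc by (auto simp: pt_def B1_def B2_def B4_def dim)
    next
      case False
      then show ?thesis using low evf0 rc
        by (auto simp: pt_def B1_def B2_def B4_def dim F_def K_def)
    qed
    then show "Matrix.mat (2 * n) (2 * n) (\<lambda>(r, c). hom_eval (2 * n - 1) (rs r) (pt c)) $$ (r, c)
      = four_block_mat B1 B2 (0\<^sub>m m K) B4 $$ (r, c)" using rc by simp
  qed (auto simp: B1_def B4_def dim)
  moreover have "Determinant.det (four_block_mat B1 B2 (0\<^sub>m m K) B4) = Determinant.det B1 * Determinant.det B4"
    by (rule det_four_block_mat_lower_left_zero[where n = K and m = m]) (auto simp: B1_def B2_def B4_def)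
  moreover have "Matrix.mat (2 * n) (2 * n) (\<lambda>(i, c). hom_eval (2 * n - 1) (map rs [0..<2 * n] ! i) (pt c))
    = Matrix.mat (2 * n) (2 * n) (\<lambda>(r, c). hom_eval (2 * n - 1) (rs r) (pt c))"
    by (intro eq_matI) auto
  ultimately have RV: "R * cmod (Determinant.det (vandermonde_mat (2 * n) pt)) = cmod (Determinant.det B1) * cmod (Determinant.det B4)"
    unfolding R using absdet_times_vandermonde[of "2 * n" "map rs [0..<2 * n]" pt] n
    by (simp add: norm_mult)
  have "Determinant.det B1 = (\<Prod>r<K. if r = 0 then - 1 else 1) * (\<Prod>c<K. H c) * Determinant.det (vandermonde_mat K p)"
    unfolding B1_def det_scale vandermonde_mat_def ..
  moreover have "cmod (\<Prod>r<K. if r = 0 then - 1 else 1) = 1"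
    unfolding prod_norm[symmetric] by (rule prod.neutral) auto
  ultimately have B1: "cmod (Determinant.det B1) = (\<Prod>c<K. cmod (H c)) * (\<Prod>j<K. \<Prod>i<j. W (p i) (p j))"
    by (simp add: norm_mult norm_det_vandermonde prod_norm[symmetric] W_def)
  have "Determinant.det B4 = (\<Prod>r<m. of_nat (n + 1)) * (\<Prod>c<m. F c) * Determinant.det (vandermonde_mat m q)"
    unfolding B4_def det_scale vandermonde_mat_def ..
  then have B4: "cmod (Determinant.det B4) = real (n + 1) ^ m * (\<Prod>c<m. cmod (F c)) * (\<Prod>j<m. \<Prod>i<j. W (q i) (q j))"
    by (simp only: norm_mult norm_det_vandermonde prod_norm[symmetric] W_def prod_constant norm_power norm_of_nat card_lessThan)
  have split: "(\<Prod>j<K + l. \<Prod>i<j. W (pt i) (pt j)) = (\<Prod>j<K. \<Prod>i<j. W (p i) (p j)) *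
      ((\<Prod>j<l. \<Prod>i<K. W (p i) (q j)) * (\<Prod>j<l. \<Prod>i<j. W (q i) (q j)))" for l
  proof (induction l)
    case 0
    show ?case by (auto simp: pt_def intro!: prod.cong)
  next
    case (Suc l)
    have "(\<Prod>i<K + l'. W (pt i) (q l)) = (\<Prod>i<K. W (p i) (q l)) * (\<Prod>i<l'. W (q i) (q l))" for l'
    proof (induction l')
      case 0
      show ?case by (auto simp: pt_def intro!: prod.cong)
    qed (simp add: pt_def)
    moreover have "pt (K + l) = q l" by (simp add: pt_def)
    ultimately show ?case by (simp add: Suc.IH)
  qed
  have V: "cmod (Determinant.det (vandermonde_mat (2 * n) pt)) = (\<Prod>j<K. \<Prod>i<j. W (p i) (p j)) *
      ((\<Prod>j<m. \<Prod>i<K. W (p i) (q j)) * (\<Prod>j<m. \<Prod>i<j. W (q i) (q j)))"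
    using split[of m] unfolding norm_det_vandermonde dim by (simp add: W_def)
  have nz1: "(\<Prod>j<K. \<Prod>i<j. W (p i) (p j)) \<noteq> 0"
    using distinct by (auto simp: W_def p_def wedge_zero_of K_def)
  have nz2: "(\<Prod>j<m. \<Prod>i<K. W (p i) (q j)) \<noteq> 0" using q(1) by (auto simp: W_def)
  have nz3: "(\<Prod>j<m. \<Prod>i<j. W (q i) (q j)) \<noteq> 0" using q(2) by (auto simp: W_def)
  have "R = real (n + 1) ^ m * (\<Prod>c<K. cmod (H c))"
    using RV nz1 nz2 nz3 unfolding V B1 B4 normF by (simp add: field_simps)
  also have "(\<Prod>c<K. cmod (H c)) = (\<Prod>j<K. \<Prod>i\<in>{..<K} - {j}. W (v i) (v j))"
    using normH by (intro prod.cong) auto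
  also have "\<dots> = (\<Prod>j<K. \<Prod>i<j. W (v i) (v j)) ^ 2"
    by (rule prod_offdiag) (simp add: W_def norm_wedge_commute)
  finally show ?thesis unfolding R_def u_def w_def le_K W_def by (simp add: m)
qed

section \<open>Factorization and dehomogenization of binary forms\<close>

lemma coeff2_mult: "coeff2 (p * q) i j = (\<Sum>s\<le>j. \<Sum>r\<le>i. coeff2 p r s * coeff2 q (i - r) (j - s))"
  by (simp add: coeff2_def coeff_mult coeff_sum)

lemma homogeneous2_mult:
  assumes "homogeneous2 a p" "homogeneous2 b q"
  shows "homogeneous2 (a + b) (p * q)"
  unfolding homogeneous2_def
proof (intro allI impI)
  fix i j assume "coeff2 (p * q) i j \<noteq> 0"
  then obtain s r where "s \<le> j" "r \<le> i" "coeff2 p r s \<noteq> 0" "coeff2 q (i - r) (j - s) \<noteq> 0"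
    unfolding coeff2_mult by (metis (no_types, lifting) atMost_iff mult_eq_0_iff sum.not_neutral_contains_not_neutral)
  then have "r + s = a" "(i - r) + (j - s) = b" "s \<le> j" "r \<le> i"
    using assms by (auto simp: homogeneous2_def)
  then show "i + j = a + b" by linarith
qed

lemma coeff2_monom2: "coeff2 (monom2 l m) i j = (if i = l \<and> j = m then 1 else 0)"
  by (simp add: coeff2_def monom2_def)

lemma homogeneous2_monom2: "homogeneous2 (l + m) (monom2 l m)"
  by (simp add: homogeneous2_def coeff2_monom2)

lemma homogeneous2_linear2: "homogeneous2 1 (linear2 v)"
  by (auto simp: homogeneous2_def coeff2_def linear2_def coeff_pCons split: nat.splits)

lemma homogeneous2_prod_linear2: "homogeneous2 (card I) (\<Prod>i\<in>I. linear2 (v i))" if "finite I"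
  using that
proof (induction I rule: finite_induct)
  case empty
  show ?case using homogeneous2_monom2[of 0 0] by (simp add: monom2_def one_pCons monom_0)
next
  case (insert i I)
  then show ?case using homogeneous2_mult[OF homogeneous2_linear2[of "v i"] insert.IH] by simp
qed

text \<open>A form of known degree can be recovered from its value at \<open>y = 1\<close>, that is, at the constant \<open>1\<close> of
  the outer variable.\<close>

lemma coeff_dehomogenize:
  assumes "homogeneous2 m p"
  shows "coeff (poly p 1) i = (if i \<le> m then coeff2 p i (m - i) else 0)"
proof -
  have "coeff (poly p 1) i = (\<Sum>j\<le>degree p. coeff2 p i j)"
    by (simp add: poly_altdef coeff_sum coeff2_def)
  also have "\<dots> = (\<Sum>j\<in>{..degree p} \<union> {..m}. coeff2 p i j)"
    by (rule sum.mono_neutral_left) (auto simp: coeff2_def coeff_eq_0)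
  also have "\<dots> = (\<Sum>j\<in>{..degree p} \<union> {..m}. if j = m - i then (if i \<le> m then coeff2 p i (m - i) else 0) else 0)"
    using assms by (intro sum.cong refl) (force simp: homogeneous2_def)
  finally show ?thesis by simp
qed

lemma dehomogenize_inject:
  assumes "homogeneous2 m p" "homogeneous2 m q" "poly p 1 = poly q 1"
  shows "p = q"
proof (rule poly_eqI, rule poly_eqI)
  fix j i
  have "coeff2 p i j = coeff2 q i j"
  proof (cases "i + j = m")
    case True
    then show ?thesis
      using coeff_dehomogenize[OF assms(1), of i] coeff_dehomogenize[OF assms(2), of i] assms(3) by auto
  next
    case False
    then show ?thesis using assms(1,2) by (metis homogeneous2_def)
  qed
  then show "coeff (coeff p j) i = coeff (coeff q j) i" by (simp add: coeff2_def)
qed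

lemma dehomogenize_linear2: "poly (linear2 v) 1 = lin v"
  by (simp add: linear2_def lin_def)

text \<open>If the degree is smaller than the number of factors, factors \<open>1 = lin (0, 1)\<close> are added; they
  correspond to the zero line \<open>y = 0\<close>.\<close>

lemma ex_lin_factorization: "degree f \<le> Suc N \<Longrightarrow> \<exists>v. f = (\<Prod>i\<le>N. lin (v i))"
proof (induction N arbitrary: f)
  case 0
  have "f = lin (coeff f 1, coeff f 0)"
  proof (rule poly_eqI)
    fix k show "coeff f k = coeff (lin (coeff f 1, coeff f 0)) k"
    proof (cases "k \<ge> 2")
      case True
      then have "coeff f k = 0" using 0 by (intro coeff_eq_0) simp
      then show ?thesis using True by (auto simp: lin_def coeff_pCons split: nat.splits)
    next
      case False
      then have "k = 0 \<or> k = 1" by auto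
      then show ?thesis by (auto simp: lin_def)
    qed
  qed
  then show ?case by (intro exI[of _ "\<lambda>_. (coeff f 1, coeff f 0)"]) simp
next
  case (Suc N)
  obtain g x where g: "f = lin x * g" "degree g \<le> Suc N"
  proof (cases "degree f \<le> Suc N")
    case True
    then show thesis using that[of "(0, 1)" f] by (simp add: lin_def one_pCons[symmetric])
  next
    case False
    then have "\<not> constant (poly f)" by (simp add: constant_degree)
    then obtain r where "poly f r = 0" using fundamental_theorem_of_algebra by blast
    then obtain g where g: "f = [:- r, 1:] * g" using poly_eq_0_iff_dvd by blast
    then have "g \<noteq> 0" using False by auto
    then have "degree f = Suc (degree g)" unfolding g by (subst degree_mult_eq) auto
    then show thesis using that[of "(1, - r)" g] g Suc.prems by (simp add: lin_def)
  qed
  obtain v where v: "g = (\<Prod>i\<le>N. lin (v i))" using Suc.IH[OF g(2)] by blast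
  have "f = (\<Prod>i\<le>Suc N. lin ((v(Suc N := x)) i))"
    unfolding g(1) v by (simp add: mult.commute)
  then show ?case by blast
qed

lemma ex_linear2_factorization:
  assumes "homogeneous2 (n + 1) h"
  shows "\<exists>v. h = (\<Prod>i\<le>n. linear2 (v i))"
proof -
  have "degree (poly h 1) \<le> Suc n"
    by (rule degree_le) (simp add: coeff_dehomogenize[OF assms])
  then obtain v where v: "poly h 1 = (\<Prod>i\<le>n. lin (v i))" using ex_lin_factorization by blast
  have "h = (\<Prod>i\<le>n. linear2 (v i))"
    by (rule dehomogenize_inject[OF assms])
      (use homogeneous2_prod_linear2[of "{..n}" v] v in \<open>simp_all add: poly_prod dehomogenize_linear2\<close>)
  then show ?thesis by blast
qed

lemma eval2_prod_linear2:
  "eval2 (\<Prod>i\<in>I. linear2 (v i)) z = (\<Prod>i\<in>I. fst (v i) * fst z + snd (v i) * snd z)"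
  by (simp add: eval2_def poly_prod linear2_def mult.commute add.commute)

section \<open>Zero lines of a generic form\<close>

lemma wedge_eq_0_imp_scalar:
  assumes "wedge v w = 0" "v \<noteq> 0"
  obtains t where "w = (t * fst v, t * snd v)"
proof (cases "fst v = 0")
  case True
  then have "snd v \<noteq> 0" "fst w = 0" using assms by (auto simp: prod_eq_iff wedge_def)
  then show thesis using True that[of "snd w / snd v"] by (simp add: prod_eq_iff)
next
  case False
  then show thesis using assms(1) that[of "fst w / fst v"]
    by (simp add: prod_eq_iff wedge_def field_simps)
qed

lemma generic2_imp_nonzero: "generic2 h \<Longrightarrow> h \<noteq> 0"
proof
  assume "generic2 h" "h = 0"
  moreover have "cspan (1, 0) \<in> zero_lines 0"
    unfolding zero_lines_def by (intro CollectI exI[of _ "(1, 0)"]) (simp add: eval2_def prod_eq_iff)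
  ultimately have "multiplicity (linear2 (0, - 1)) h = 1"
    using \<open>generic2 h\<close>[unfolded generic2_def, rule_format, of 1 0] by auto
  then show False using \<open>h = 0\<close> by simp
qed

lemma prod_linear2_nonzeroD:
  fixes n l :: nat
  assumes "(\<Prod>i\<le>n. linear2 (v i)) \<noteq> 0" "l \<le> n"
  shows "v l \<noteq> 0"
proof
  assume "v l = 0"
  then have "linear2 (v l) = 0" by (simp add: linear2_def)
  then have "(\<Prod>i\<le>n. linear2 (v i)) = 0" using assms(2) by (intro prod_zero) auto
  with assms(1) show False by simp
qed

text \<open>Two proportional factors would give a zero line of multiplicity at least 2.\<close>

lemma generic2_imp_wedge_nonzero:
  fixes n :: nat
  assumes "generic2 h" and h: "h = (\<Prod>i\<le>n. linear2 (v i))" and ij: "i < j" "j \<le> n"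
  shows "wedge (v i) (v j) \<noteq> 0"
proof
  assume w: "wedge (v i) (v j) = 0"
  have "h \<noteq> 0" using assms(1) by (rule generic2_imp_nonzero)
  then have nz: "v l \<noteq> 0" if "l \<le> n" for l
    using that prod_linear2_nonzeroD[of v n] unfolding h by blast
  obtain t where t: "v j = (t * fst (v i), t * snd (v i))"
    using wedge_eq_0_imp_scalar[OF w] nz ij by auto
  have "linear2 (v j) = [:[:t:]:] * linear2 (v i)" by (simp add: t linear2_def)
  then have "linear2 (v i) * linear2 (v j) = linear2 (v i) ^ 2 * [:[:t:]:]"
    by (simp only: power2_eq_square mult_ac)
  then have "linear2 (v i) ^ 2 dvd linear2 (v i) * linear2 (v j)" by (rule dvdI)
  also have "linear2 (v i) * linear2 (v j) dvd h"
  proof -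
    have "(\<Prod>l\<in>{i, j}. linear2 (v l)) dvd h"
      unfolding h using ij by (intro prod_dvd_prod_subset) auto
    then show ?thesis using ij by simp
  qed
  finally have dvd: "linear2 (v i) ^ 2 dvd h" .
  let ?a = "- snd (v i)" and ?b = "fst (v i)"
  have "eval2 h (?a, ?b) = 0"
    unfolding h eval2_prod_linear2 using ij by (auto intro!: bexI[of _ i])
  moreover have ab: "(?a, ?b) \<noteq> 0" using nz[of i] ij by (auto simp: prod_eq_iff)
  ultimately have "cspan (?a, ?b) \<in> zero_lines h" unfolding zero_lines_def by blast
  then have m: "multiplicity (linear2 (v i)) h = 1"
    using assms(1)[unfolded generic2_def, rule_format, of ?a ?b] ab by (simp add: zero_prod_def)
  then have "\<not> is_unit (linear2 (v i))" by (metis multiplicity_unit_left zero_neq_one)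
  then have "2 \<le> multiplicity (linear2 (v i)) h"
    using dvd \<open>h \<noteq> 0\<close> by (intro multiplicity_geI) auto
  with m show False by simp
qed

lemma cspan_scale: "t \<noteq> 0 \<Longrightarrow> cspan (t * fst v, t * snd v) = cspan v"
proof -
  assume t: "t \<noteq> 0"
  have "(s * fst v, s * snd v) \<in> range (\<lambda>r. (r * (t * fst v), r * (t * snd v)))" for s
    by (rule range_eqI[of _ _ "s / t"]) (use t in simp)
  then show ?thesis unfolding cspan_def by (auto simp: mult.assoc[symmetric])
qed

lemma zero_lines_prod_linear2_subset:
  fixes n :: nat
  assumes "\<And>i. i \<le> n \<Longrightarrow> v i \<noteq> 0"
  shows "zero_lines (\<Prod>i\<le>n. linear2 (v i)) \<subseteq> (\<lambda>i. cspan (zero_of (v i))) ` {..n}"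
proof
  fix L assume "L \<in> zero_lines (\<Prod>i\<le>n. linear2 (v i))"
  then obtain z where z: "L = cspan z" "z \<noteq> 0" "eval2 (\<Prod>i\<le>n. linear2 (v i)) z = 0"
    unfolding zero_lines_def by blast
  from z(3) have "\<exists>i\<in>{..n}. fst (v i) * fst z + snd (v i) * snd z = 0"
    unfolding eval2_prod_linear2 by (simp only: prod_zero_iff[OF finite_atMost])
  then obtain i where i: "i \<le> n" "fst (v i) * fst z + snd (v i) * snd z = 0" by auto
  have "wedge (zero_of (v i)) z = 0" using i(2) by (simp add: wedge_def zero_of_def algebra_simps)
  moreover have "zero_of (v i) \<noteq> 0" using assms[OF i(1)] by (auto simp: zero_of_def prod_eq_iff)
  ultimately obtain t where t: "z = (t * fst (zero_of (v i)), t * snd (zero_of (v i)))"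
    by (rule wedge_eq_0_imp_scalar)
  then have "t \<noteq> 0" using z(2) by (auto simp: prod_eq_iff)
  then have "L = cspan (zero_of (v i))" unfolding z(1) t by (rule cspan_scale)
  then show "L \<in> (\<lambda>i. cspan (zero_of (v i))) ` {..n}" using i(1) by blast
qed

lemma fubini_study_nonneg:
  assumes "u \<noteq> 0" "v \<noteq> 0"
  shows "0 \<le> fubini_study (cspan u) (cspan v)"
proof -
  define nrm where "nrm z = (of_real (1 / norm z) * fst z, of_real (1 / norm z) * snd z)"
    for z :: "complex \<times> complex"
  have nrm: "norm (nrm z) = 1" "cspan (nrm z) = cspan z" if "z \<noteq> 0" for z
  proof -
    have "nrm z = (1 / norm z) *\<^sub>R z" by (simp add: nrm_def prod_eq_iff scaleR_conv_of_real)
    then show "norm (nrm z) = 1" using that by simp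
    show "cspan (nrm z) = cspan z" unfolding nrm_def using that by (intro cspan_scale) simp
  qed
  have "cmod (hermitian2 a b) \<le> 1" if "norm a = 1" "norm b = 1" for a b
  proof -
    have "cmod (hermitian2 a b) \<le> cmod (fst a) * cmod (fst b) + cmod (snd a) * cmod (snd b)"
      unfolding hermitian2_def by (rule order.trans[OF norm_triangle_ineq]) (simp add: norm_mult)
    also have "\<dots> = (cmod (fst a), cmod (snd a)) \<bullet> (cmod (fst b), cmod (snd b))" by simp
    also have "\<dots> \<le> norm (cmod (fst a), cmod (snd a)) * norm (cmod (fst b), cmod (snd b))"
      by (rule norm_cauchy_schwarz)
    also have "\<dots> = norm a * norm b" by (simp add: norm_prod_def)
    finally show ?thesis using that by simp
  qed
  then have "0 \<le> arccos (cmod (hermitian2 (nrm u) (nrm v)))"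
    using nrm assms by (intro arccos_lbound) (auto intro: order.trans[of _ 0])
  then show ?thesis using fubini_study_cspan[of "nrm u" "nrm v"] nrm assms by simp
qed

text \<open>The minimum in \<open>c1\<close> is taken over a finite set, as every zero line is the line of some factor, and
  over a nonempty one, as a generic form of degree at least 2 has two different zero lines.\<close>

lemma c_prime_bounds:
  assumes "n \<ge> 1" "generic2 h" and h: "h = (\<Prod>i\<le>n. linear2 (v i))"
  shows "0 \<le> c_prime n h" "c_prime n h \<le> 1"
proof -
  let ?D = "{fubini_study L M | L M. L \<in> zero_lines h \<and> M \<in> zero_lines h \<and> L \<noteq> M}"
  have "h \<noteq> 0" using assms(2) by (rule generic2_imp_nonzero)
  then have nz: "v l \<noteq> 0" if "l \<le> n" for l
    using that prod_linear2_nonzeroD[of v n] unfolding h by blast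
  have fin: "finite (zero_lines h)"
    unfolding h by (rule finite_subset[OF zero_lines_prod_linear2_subset]) (use nz in auto)
  have "?D \<subseteq> (\<lambda>(L, M). fubini_study L M) ` (zero_lines h \<times> zero_lines h)" by auto
  then have "finite ?D" using fin by (meson finite_SigmaI finite_imageI finite_subset)
  have line: "cspan (zero_of (v i)) \<in> zero_lines h" if "i \<le> n" for i
  proof -
    have "zero_of (v i) \<noteq> 0" using nz[OF that] by (auto simp: zero_of_def prod_eq_iff)
    moreover have "eval2 h (zero_of (v i)) = 0"
      unfolding h eval2_prod_linear2 using that by (auto simp: zero_of_def intro!: bexI[of _ i])
    ultimately show ?thesis unfolding zero_lines_def by blast
  qed
  have "cspan (zero_of (v 0)) \<noteq> cspan (zero_of (v 1))"
  proof
    assume eq: "cspan (zero_of (v 0)) = cspan (zero_of (v 1))"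
    have "zero_of (v 1) \<in> cspan (zero_of (v 1))"
      unfolding cspan_def by (rule range_eqI[of _ _ 1]) simp
    then have "zero_of (v 1) \<in> cspan (zero_of (v 0))" unfolding eq .
    then obtain t where "zero_of (v 1) = (t * fst (zero_of (v 0)), t * snd (zero_of (v 0)))"
      unfolding cspan_def by auto
    then have "wedge (zero_of (v 0)) (zero_of (v 1)) = 0" by (simp add: wedge_def)
    then show False
      using generic2_imp_wedge_nonzero[OF assms(2) h, of 0 1] assms(1) by (simp add: wedge_zero_of)
  qed
  then have "?D \<noteq> {}" using line[of 0] line[of 1] assms(1) by blast
  have "0 \<le> Min ?D"
    using \<open>finite ?D\<close> \<open>?D \<noteq> {}\<close> by (auto simp: zero_lines_def intro!: fubini_study_nonneg)
  then show "0 \<le> c_prime n h" by (simp add: c_prime_def c1_def)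
  show "c_prime n h \<le> 1" by (simp add: c_prime_def)
qed

section \<open>Coefficients of a form of bounded maximum norm\<close>

text \<open>The Cauchy estimate, in discrete form: averaging \<open>f(\<zeta>) \<zeta>\<^bsup>-i\<^esup>\<close> over the roots of unity \<open>\<zeta>\<close> of an order
  larger than the degree isolates the coefficient of index \<open>i\<close>.\<close>

lemma norm_coeff_le_circle_bound:
  assumes "\<And>z. cmod z = 1 \<Longrightarrow> cmod (poly f z) \<le> B" "B \<ge> 0"
  shows "cmod (coeff f i) \<le> B"
proof (cases "i \<le> degree f")
  case False
  then show ?thesis using assms(2) by (simp add: coeff_eq_0)
next
  case True
  define M where "M = Suc (degree f)"
  define e where "e k = exp (2 * of_real pi * \<i> * of_nat k / of_nat M)" for k
  have M: "1 \<le> M" by (simp add: M_def)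
  have ne: "cmod (e k) = 1" for k by (simp add: e_def)
  have eM: "e k ^ M = 1" for k using complex_root_unity[of M k] M by (simp add: e_def)
  have geo: "(\<Sum>j<M. (e k / e i) ^ j) = (if k = i then of_nat M else 0)" if "k < M" for k
  proof (cases "k = i")
    case False
    have "e k \<noteq> e i"
      using False that True complex_root_unity_eq[OF M, of k i] by (simp add: e_def M_def)
    moreover have "e i \<noteq> 0" by (simp add: e_def)
    ultimately have "e k / e i \<noteq> 1" by simp
    then have "(\<Sum>j<M. (e k / e i) ^ j) = ((e k / e i) ^ M - 1) / (e k / e i - 1)"
      by (rule geometric_sum)
    then show ?thesis using False by (simp add: eM power_divide)
  qed (simp add: e_def)
  have pf: "poly f z = (\<Sum>k<M. coeff f k * z ^ k)" for z
    unfolding M_def lessThan_Suc_atMost poly_altdef ..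
  have e1: "e k = e 1 ^ k" for k
  proof -
    have "e k = exp (of_nat k * (2 * of_real pi * \<i> / of_nat M))" by (simp add: e_def mult_ac)
    also have "\<dots> = e 1 ^ k" unfolding exp_of_nat_mult by (simp add: e_def)
    finally show ?thesis .
  qed
  have ee: "e k ^ j = (e 1 ^ j) ^ k" for k j
    unfolding e1[of k] by (simp only: power_mult[symmetric] mult.commute)
  have "(\<Sum>j<M. poly f (e 1 ^ j) / e i ^ j) = (\<Sum>j<M. \<Sum>k<M. coeff f k * (e k / e i) ^ j)"
    unfolding pf sum_divide_distrib power_divide ee[symmetric] times_divide_eq_right ..
  also have "\<dots> = (\<Sum>k<M. \<Sum>j<M. coeff f k * (e k / e i) ^ j)" by (rule sum.swap)
  also have "\<dots> = (\<Sum>k<M. coeff f k * (if k = i then of_nat M else 0))"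
    by (intro sum.cong refl) (simp only: sum_distrib_left[symmetric] lessThan_iff geo)
  also have "\<dots> = (\<Sum>k<M. if k = i then of_nat M * coeff f i else 0)" by (intro sum.cong) auto
  also have "\<dots> = of_nat M * coeff f i" using True by (simp add: M_def)
  finally have "of_nat M * coeff f i = (\<Sum>j<M. poly f (e 1 ^ j) / e i ^ j)" ..
  then have "real M * cmod (coeff f i) = cmod (\<Sum>j<M. poly f (e 1 ^ j) / e i ^ j)"
    by (metis norm_mult norm_of_nat)
  also have "\<dots> \<le> (\<Sum>j<M. B)"
    by (rule order.trans[OF norm_sum], intro sum_mono)
      (use assms(1) ne in \<open>simp add: norm_divide norm_power\<close>)
  finally show ?thesis using M by simp
qed

lemma norm_eval2_le_max_norm2:
  assumes h: "h = (\<Prod>i\<le>n. linear2 (v i))" and xy: "(cmod x)\<^sup>2 + (cmod y)\<^sup>2 = 1"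
  shows "cmod (eval2 h (x, y)) \<le> max_norm2 h"
  unfolding max_norm2_def
proof (rule cSUP_upper2[where x = "(x, y)"])
  have "cmod (eval2 h (a, b)) \<le> (\<Prod>i\<le>n. cmod (fst (v i)) + cmod (snd (v i)))"
    if ab: "(cmod a)\<^sup>2 + (cmod b)\<^sup>2 = 1" for a b
  proof -
    have "(cmod a)\<^sup>2 \<le> 1" "(cmod b)\<^sup>2 \<le> 1" using ab by (smt (verit) zero_le_power2)+
    then have "cmod a \<le> 1" "cmod b \<le> 1" by (simp_all add: abs_square_le_1)
    then have "cmod (fst (v i) * a + snd (v i) * b) \<le> cmod (fst (v i)) + cmod (snd (v i))" for i
      by (intro order.trans[OF norm_triangle_ineq] add_mono)
        (auto simp: norm_mult intro: mult_left_le)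
    then show ?thesis
      unfolding h eval2_prod_linear2 prod_norm[symmetric] by (intro prod_mono) auto
  qed
  then show "bdd_above ((\<lambda>(x, y). cmod (eval2 h (x, y))) ` {(x, y). (cmod x)\<^sup>2 + (cmod y)\<^sup>2 = 1})"
    by (intro bdd_aboveI[of _ "\<Prod>i\<le>n. cmod (fst (v i)) + cmod (snd (v i))"]) auto
qed (use xy in auto)

text \<open>If \<open>\<bar>z\<bar> = 1\<close>, then \<open>(z, 1) / sqrt 2\<close> lies on the unit sphere.\<close>

lemma norm_coeff_dehomogenize_le:
  assumes h: "h = (\<Prod>i\<le>n. linear2 (v i))"
  shows "cmod (coeff (poly h 1) i) \<le> sqrt 2 ^ (n + 1) * max_norm2 h"
proof (rule norm_coeff_le_circle_bound)
  fix z :: complex assume z: "cmod z = 1"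
  define s where "s = complex_of_real (1 / sqrt 2)"
  have s: "cmod s = 1 / sqrt 2" by (simp add: s_def norm_divide)
  have "eval2 h (s * z, s) = (\<Prod>i\<le>n. s * poly (lin (v i)) z)"
    unfolding h eval2_prod_linear2 by (simp add: lin_def algebra_simps)
  also have "\<dots> = s ^ (n + 1) * poly (poly h 1) z"
    unfolding h by (simp add: prod.distrib poly_prod dehomogenize_linear2)
  finally have "cmod (poly (poly h 1) z) = sqrt 2 ^ (n + 1) * cmod (eval2 h (s * z, s))"
    by (simp add: norm_mult norm_power s power_divide)
  also have "\<dots> \<le> sqrt 2 ^ (n + 1) * max_norm2 h"
    by (intro mult_left_mono norm_eval2_le_max_norm2[OF h]) (auto simp: norm_mult s z power_divide)
  finally show "cmod (poly (poly h 1) z) \<le> sqrt 2 ^ (n + 1) * max_norm2 h" .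
next
  have "0 \<le> cmod (eval2 h (1, 0))" by simp
  also have "\<dots> \<le> max_norm2 h" by (rule norm_eval2_le_max_norm2[OF h]) simp
  finally show "0 \<le> sqrt 2 ^ (n + 1) * max_norm2 h" by simp
qed

section \<open>The determinants P_d\<close>

lemma coeff2_pderiv_y: "coeff2 (pderiv_y h) i j = of_nat (Suc j) * coeff2 h i (Suc j)"
  by (simp add: coeff2_def pderiv_y_def coeff_pderiv of_nat_poly)

lemma coeff2_pderiv_x: "coeff2 (pderiv_x h) i j = of_nat (Suc i) * coeff2 h (Suc i) j"
  by (simp add: coeff2_def pderiv_x_def coeff_map_poly coeff_pderiv)

lemma homogeneous2_pderiv:
  assumes "homogeneous2 (n + 1) h"
  shows "homogeneous2 n (pderiv_x h)" "homogeneous2 n (pderiv_y h)"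
  using assms unfolding homogeneous2_def coeff2_pderiv_x coeff2_pderiv_y by fastforce+

lemma dehomogenize_pderiv_x:
  assumes "homogeneous2 (n + 1) h"
  shows "poly (pderiv_x h) 1 = pderiv (poly h 1)"
  by (rule poly_eqI)
    (simp add: coeff_dehomogenize[OF homogeneous2_pderiv(1)[OF assms]] coeff_pderiv
      coeff_dehomogenize[OF assms] coeff2_pderiv_x)

lemma dehomogenize_pderiv_y:
  assumes "homogeneous2 (n + 1) h"
  shows "poly (pderiv_y h) 1 = dual_deriv (n + 1) (poly h 1)"
proof (rule poly_eqI)
  fix i
  consider "i \<le> n" | "i = n + 1" | "i > n + 1" by linarith
  then show "coeff (poly (pderiv_y h) 1) i = coeff (dual_deriv (n + 1) (poly h 1)) i"
    unfolding coeff_dual_deriv coeff_dehomogenize[OF homogeneous2_pderiv(2)[OF assms]]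
      coeff_dehomogenize[OF assms]
    by cases (auto simp: coeff2_pderiv_y Suc_diff_le of_nat_diff algebra_simps)
qed

lemma D_form_monomial_form:
  "D_form (monomial_form l m) = Polynomial.smult [:- of_nat (Suc m):] (monom2 l m)"
proof -
  have "D_form (monomial_form l m) = - pderiv (monom (monom 1 l) (Suc m))"
    by (simp add: D_form_def monomial_form_def pderiv_x_def pderiv_y_def monom2_def)
  also have "pderiv (monom (monom 1 l) (Suc m)) = Polynomial.smult [:of_nat (Suc m):] (monom2 l m)"
    by (simp add: monom2_def pderiv_monom of_nat_poly smult_monom del: of_nat_Suc)
  also have "- \<dots> = Polynomial.smult (- [:of_nat (Suc m):]) (monom2 l m)"
    by (simp only: smult_minus_left)
  also have "- [:of_nat (Suc m):] = [:- of_nat (Suc m) :: complex:]" by simp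
  finally show ?thesis .
qed

lemma homogeneous_form_monomial_form: "homogeneous_form e (monomial_form l m) \<longleftrightarrow> e = l + m + 1"
  by (auto simp: homogeneous_form_def monomial_form_def homogeneous2_def coeff2_monom2)
    (auto simp: coeff2_def)

text \<open>At \<open>y = 1\<close>, the rows of \<open>A_mat\<close> that come from the forms are unit rows multiplied by
  \<open>-(m + 1) / (n - r + 1)\<close>, a number of modulus at least \<open>1 / n\<close>. The bound \<open>1 / n\<close> also holds for
  the factor \<open>1\<close> of the other rows, which makes the exponent the number of all rows.\<close>

lemma P_det_ge_absdet:
  assumes hom: "homogeneous2 (n + 1) h" and n: "n \<ge> 1" and d: "n \<le> d" "d \<le> 2 * n - 2"
    and len: "length cs = 2 * n - d - 1" and le: "\<And>c. c \<in> set cs \<Longrightarrow> c \<le> d"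
    and \<Omega>: "forms_of_degree (d + 1) \<Omega> = map (\<lambda>c. monomial_form c (d - c)) cs"
  defines "k \<equiv> d - n + 1" and "f \<equiv> poly h 1"
  shows "(1 / real n) ^ (d + 1) * absdet (d + 1)
      (shifts k (dual_deriv (n + 1) f) @ shifts k (pderiv f) @ map (monom 1) cs)
    \<le> cmod (P_det n d h \<Omega>)"
proof -
  let ?\<Omega> = "map (\<lambda>c. monomial_form c (d - c)) cs"
  let ?rows = "A_rows n d h ?\<Omega>"
  define N where "N = d + 1"
  define qs where "qs = shifts k (dual_deriv (n + 1) f) @ map (monom 1) cs @ shifts k (pderiv f)"
  note pd = homogeneous2_pderiv[OF hom]
  have "d + 1 = (d - n + 1) + (2 * n - d - 1) + (d - n + 1)" using d n by linarith
  then have lenrows: "length ?rows = N" and lenqs: "length qs = N"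
    using len by (auto simp: A_rows_def qs_def k_def N_def)
  have shift: "homogeneous2 d (monom2 j (d - n - j) * q)" if "j \<le> d - n" "homogeneous2 n q" for j q
    using homogeneous2_mult[OF homogeneous2_monom2 that(2), of j "d - n - j"] that d by simp
  have dm: "poly (monom2 j l) 1 = monom 1 j" for j l by (simp add: monom2_def poly_monom)
  have row: "homogeneous2 d (?rows ! i) \<and>
      (\<exists>r. poly (?rows ! i) 1 = Polynomial.smult r (qs ! i) \<and> 1 / real n \<le> cmod r)" if "i < N" for i
  proof -
    consider "i < k" | "k \<le> i" "i < k + length cs" | "k + length cs \<le> i" by linarith
    then show ?thesis
    proof cases
      case 1
      then have r: "?rows ! i = monom2 i (d - n - i) * pderiv_y h"
        by (auto simp: A_rows_def nth_append k_def simp del: upt_Suc)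
      have q: "qs ! i = monom 1 i * dual_deriv (n + 1) f"
        using 1 by (auto simp: qs_def nth_append shifts_def simp del: upt_Suc)
      have "i \<le> d - n" using 1 by (simp add: k_def)
      then show ?thesis
        unfolding r q using shift pd n
        by (intro conjI exI[of _ 1]) (auto simp: dm dehomogenize_pderiv_y[OF hom] f_def)
    next
      case 2
      define s where "s = i - k"
      define c where "c = cs ! s"
      have s: "s < length cs" using 2 by (auto simp: s_def)
      have c: "c \<le> d" using le s by (auto simp: c_def)
      have sn: "s + 1 < n" using s len d by linarith
      have i: "i = k + s" using 2 by (simp add: s_def)
      define a :: complex where "a = 1 / (of_nat n - of_nat (s + 1) + 1)"
      have r: "?rows ! i = Polynomial.smult [:a:] (D_form (monomial_form c (d - c)))"
        using s len d unfolding i c_def a_def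
        by (auto simp: A_rows_def nth_append k_def simp del: upt_Suc)
      have r': "?rows ! i = Polynomial.smult [:a * - of_nat (Suc (d - c)):] (monom2 c (d - c))"
        unfolding r D_form_monomial_form by (simp add: mult.commute del: of_nat_Suc)
      have q: "qs ! i = monom 1 c"
        using s by (auto simp: qs_def nth_append i c_def)
      have hom': "homogeneous2 d (?rows ! i)"
        unfolding r' using c by (auto simp: homogeneous2_def coeff2_def monom2_def split: if_splits)
      have "a = 1 / of_real (real n - real s)" by (simp add: a_def)
      then have "cmod a = 1 / \<bar>real n - real s\<bar>" by (simp only: norm_divide norm_of_real norm_one)
      then have a: "cmod a = 1 / (real n - real s)" using sn by simp
      have "1 / real n \<le> 1 / (real n - real s)" using sn by (intro divide_left_mono) auto
      also have "\<dots> = cmod a * 1" using a by simp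
      also have "\<dots> \<le> cmod a * real (Suc (d - c))" by (intro mult_left_mono) auto
      also have "\<dots> = cmod (a * - of_nat (Suc (d - c)))"
        by (simp only: norm_mult norm_minus_cancel norm_of_nat)
      finally have "1 / real n \<le> cmod (a * - of_nat (Suc (d - c)))" .
      moreover have "poly (?rows ! i) 1 = Polynomial.smult (a * - of_nat (Suc (d - c))) (qs ! i)"
        unfolding r' q by (simp add: dm del: of_nat_Suc)
      ultimately show ?thesis using hom' by blast
    next
      case 3
      define j where "j = i - k - length cs"
      have i: "i = k + length cs + j" using 3 by (simp add: j_def)
      have j: "j \<le> d - n" using that d len unfolding i by (auto simp: k_def N_def)
      then have r: "?rows ! i = monom2 j (d - n - j) * pderiv_x h"
        unfolding i using len d by (auto simp: A_rows_def nth_append k_def simp del: upt_Suc)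
      have q: "qs ! i = monom 1 j * pderiv f"
        using j by (auto simp: qs_def nth_append shifts_def i k_def simp del: upt_Suc)
      show ?thesis
        unfolding r q using shift pd n j
        by (intro conjI exI[of _ 1]) (auto simp: dm dehomogenize_pderiv_x[OF hom] f_def)
    qed
  qed
  have "A_mat n d h ?\<Omega> = Matrix.mat N N (\<lambda>(i, k). coeff (map (\<lambda>p. poly p 1) ?rows ! i) k)"
    unfolding A_mat_def N_def[symmetric]
  proof (intro cong_mat refl)
    fix i c assume "i < N" "c < N"
    then show "(case (i, c) of (i, k) \<Rightarrow> coeff2 (?rows ! i) k (d - k)) =
        (case (i, c) of (i, k) \<Rightarrow> coeff (map (\<lambda>p. poly p 1) ?rows ! i) k)"
      using coeff_dehomogenize[of d "?rows ! i" c] row[of i] lenrows by (simp add: N_def)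
  qed
  then have P: "cmod (P_det n d h \<Omega>) = absdet N (map (\<lambda>p. poly p 1) ?rows)"
    unfolding P_det_def \<Omega> absdet_def by simp
  have "absdet N (shifts k (dual_deriv (n + 1) f) @ shifts k (pderiv f) @ map (monom 1) cs) = absdet N qs"
    by (rule absdet_mset_cong) (use lenqs in \<open>auto simp: qs_def\<close>)
  moreover have "(1 / real n) ^ N * absdet N qs \<le> absdet N (map (\<lambda>p. poly p 1) ?rows)"
    by (rule absdet_ge_scaled_rows) (use lenqs lenrows row in auto)
  ultimately show ?thesis unfolding P N_def[symmetric] by simp
qed

section \<open>Tuples of monomial forms\<close>

text \<open>In degree \<open>d + 1\<close> the tuple consists of the forms \<open>x\<^sup>c y\<^bsup>d-c+1\<^esup> dx\<close>: all of them if \<open>d < n\<close>, as a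
  standard tuple requires, and those with \<open>c\<close> in the list \<open>cs d\<close> otherwise.\<close>

definition tuple_of_exponents :: "nat \<Rightarrow> (nat \<Rightarrow> nat list) \<Rightarrow> form1 list" where
  "tuple_of_exponents n cs = concat (map (\<lambda>d. map (\<lambda>c. monomial_form c (d - c))
     (if d < n then [0..<d + 1] else cs d)) [0..<2 * n - 1])"

lemma forms_of_degree_tuple_of_exponents:
  assumes "n \<ge> 1" and le: "\<And>d c. n \<le> d \<Longrightarrow> d \<le> 2 * n - 2 \<Longrightarrow> c \<in> set (cs d) \<Longrightarrow> c \<le> d"
    and e: "n \<le> e" "e \<le> 2 * n - 2"
  shows "forms_of_degree (e + 1) (tuple_of_exponents n cs) = map (\<lambda>c. monomial_form c (e - c)) (cs e)"
proof -
  let ?ch = "\<lambda>d. map (\<lambda>c. monomial_form c (d - c)) (if d < n then [0..<d + 1] else cs d)"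
  have chunk: "filter (homogeneous_form (e + 1)) (?ch d) = (if d = e then ?ch e else [])"
    if "d \<in> {0..<2 * n - 1}" for d
  proof -
    have "c + (d - c) = d" if "c \<in> set (if d < n then [0..<d + 1] else cs d)" for c
      using that le[of d c] \<open>d \<in> _\<close> by (auto split: if_splits)
    then show ?thesis
      unfolding filter_map comp_def homogeneous_form_monomial_form
      by (auto intro: filter_True filter_False simp: filter_empty_conv)
  qed
  have "concat (map (\<lambda>d. if d = e then ?ch e else []) [0..<N]) = (if e < N then ?ch e else [])" for N
    by (induction N) auto
  moreover have "filter (homogeneous_form (e + 1)) (tuple_of_exponents n cs)
      = concat (map (\<lambda>d. if d = e then ?ch e else []) [0..<2 * n - 1])"
    unfolding tuple_of_exponents_def filter_concat map_map comp_def using chunk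
    by (intro arg_cong[where f = concat] map_cong refl) auto
  ultimately show ?thesis using assms(1) e by (auto simp: forms_of_degree_def)
qed

lemma sum_tuple_lengths:
  fixes n :: nat
  assumes "n \<ge> 1"
  shows "(\<Sum>d<2 * n - 1. if d < n then d + 1 else 2 * n - d - 1) = n\<^sup>2"
proof -
  obtain m where m: "n = Suc m" using assms by (cases n) auto
  have split: "{..<2 * n - 1} = {..<n} \<union> {n..<2 * n - 1}" using assms by auto
  have "(\<Sum>d<2 * n - 1. if d < n then d + 1 else 2 * n - d - 1)
      = (\<Sum>d<n. d + 1) + (\<Sum>d=n..<2 * n - 1. 2 * n - d - 1)"
    unfolding split by (subst sum.union_disjoint) (auto intro!: arg_cong2[where f = "(+)"] sum.cong)
  also have "(\<Sum>d=n..<2 * n - 1. 2 * n - d - 1) = (\<Sum>i<m. i + 1)"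
    by (rule sum.reindex_bij_witness[of _ "\<lambda>i. 2 * n - 2 - i" "\<lambda>d. 2 * n - 2 - d"]) (auto simp: m)
  also have "(\<Sum>d<n. d + 1) + (\<Sum>i<m. i + 1) = n\<^sup>2"
    unfolding m by (induction m) (auto simp: power2_eq_square)
  finally show ?thesis .
qed

lemma d_standard_tuple_of_exponents:
  assumes "n \<ge> 1" and le: "\<And>d c. n \<le> d \<Longrightarrow> d \<le> 2 * n - 2 \<Longrightarrow> c \<in> set (cs d) \<Longrightarrow> c \<le> d"
    and len: "\<And>d. n \<le> d \<Longrightarrow> d \<le> 2 * n - 2 \<Longrightarrow> length (cs d) = 2 * n - d - 1"
  shows "d_standard_tuple n (tuple_of_exponents n cs)"
proof -
  have "length (tuple_of_exponents n cs) = (\<Sum>d<2 * n - 1. if d < n then d + 1 else length (cs d))"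
    by (simp add: tuple_of_exponents_def length_concat comp_def interv_sum_list_conv_sum_set_nat
        atLeast0LessThan if_distrib cong: if_cong)
  also have "\<dots> = (\<Sum>d<2 * n - 1. if d < n then d + 1 else 2 * n - d - 1)"
    using len by (intro sum.cong) auto
  finally have 1: "length (tuple_of_exponents n cs) = n\<^sup>2" using sum_tuple_lengths[OF assms(1)] by simp
  have 2: "\<exists>l m. \<omega> = monomial_form l m \<and> l + m + 1 \<le> 2 * n - 1" if "\<omega> \<in> set (tuple_of_exponents n cs)" for \<omega>
  proof -
    from that obtain d c where d: "d < 2 * n - 1" "\<omega> = monomial_form c (d - c)"
      "c \<in> set (if d < n then [0..<d + 1] else cs d)"
      unfolding tuple_of_exponents_def by auto
    then have "c \<le> d" using le[of d c] by (auto split: if_splits)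
    with d show ?thesis by (intro exI[of _ c] exI[of _ "d - c"]) auto
  qed
  have 3: "monomial_form l m \<in> set (tuple_of_exponents n cs)" if "l + m \<le> n - 1" for l m
  proof -
    have "monomial_form l m \<in> (\<lambda>c. monomial_form c (l + m - c)) ` set [0..<l + m + 1]"
      by (rule image_eqI[of _ _ l]) auto
    moreover have "l + m < n" "l + m < 2 * n - 1" using that assms(1) by auto
    ultimately show ?thesis
      unfolding tuple_of_exponents_def by (auto intro!: bexI[of _ "l + m"])
  qed
  show ?thesis
    unfolding d_standard_tuple_def standard_tuple_def
    using 1 2 3 forms_of_degree_tuple_of_exponents[of n cs, OF assms(1) le] len by auto
qed

section \<open>Numerical estimates\<close>

lemma sum_norm_partials_le:
  fixes f :: "complex poly"
  assumes "\<And>i. cmod (coeff f i) \<le> B"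
  shows "(\<Sum>c\<le>n. cmod (coeff (dual_deriv (n + 1) f) c)) \<le> (real n + 1)\<^sup>2 * B"
    "(\<Sum>c\<le>n. cmod (coeff (pderiv f) c)) \<le> (real n + 1)\<^sup>2 * B"
proof -
  have "cmod (coeff (dual_deriv (n + 1) f) c) \<le> (real n + 1) * B" if "c \<le> n" for c
  proof -
    have "coeff (dual_deriv (n + 1) f) c = of_nat (n + 1 - c) * coeff f c"
      unfolding coeff_dual_deriv using that by (subst of_nat_diff) auto
    then have "cmod (coeff (dual_deriv (n + 1) f) c) = real (n + 1 - c) * cmod (coeff f c)"
      by (simp only: norm_mult norm_of_nat)
    also have "\<dots> \<le> (real n + 1) * B" by (intro mult_mono assms) auto
    finally show ?thesis .
  qed
  then have "(\<Sum>c\<le>n. cmod (coeff (dual_deriv (n + 1) f) c)) \<le> (\<Sum>c\<le>n. (real n + 1) * B)"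
    by (intro sum_mono) auto
  also have "\<dots> = (real n + 1)\<^sup>2 * B" by (simp add: power2_eq_square)
  finally show "(\<Sum>c\<le>n. cmod (coeff (dual_deriv (n + 1) f) c)) \<le> (real n + 1)\<^sup>2 * B" .
  have "cmod (coeff (pderiv f) c) \<le> (real n + 1) * B" if "c \<le> n" for c
    unfolding coeff_pderiv norm_mult norm_of_nat using that by (intro mult_mono assms) auto
  then have "(\<Sum>c\<le>n. cmod (coeff (pderiv f) c)) \<le> (\<Sum>c\<le>n. (real n + 1) * B)"
    by (intro sum_mono) auto
  also have "\<dots> = (real n + 1)\<^sup>2 * B" by (simp add: power2_eq_square)
  finally show "(\<Sum>c\<le>n. cmod (coeff (pderiv f) c)) \<le> (real n + 1)\<^sup>2 * B" .
qed

text \<open>The left side bounds the sum of the moduli of the coefficients of a partial derivative of \<open>h\<close> when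
  the maximum norm of \<open>h\<close> is 1; a power of \<open>n\<close> is more convenient in the final count.\<close>

lemma row_norm_bound:
  assumes "n \<ge> 2"
  shows "(real n + 1)\<^sup>2 * sqrt 2 ^ (n + 1) \<le> real n ^ (3 * n)"
proof -
  have "real n + 1 \<le> real n * 2" using assms by simp
  also have "\<dots> \<le> real n * real n" using assms by (intro mult_left_mono) auto
  finally have "(real n + 1)\<^sup>2 \<le> (real n ^ 2)\<^sup>2" by (intro power_mono) (auto simp: power2_eq_square)
  also have "\<dots> \<le> real n ^ (2 * n)"
    unfolding power_mult[symmetric] using assms by (intro power_increasing) auto
  finally have 1: "(real n + 1)\<^sup>2 \<le> real n ^ (2 * n)" .
  have "sqrt 2 ^ (n + 1) \<le> sqrt 2 ^ (2 * n)" using assms by (intro power_increasing) auto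
  also have "\<dots> = 2 ^ n" by (simp add: power_mult)
  also have "\<dots> \<le> real n ^ n" using assms by (intro power_mono) auto
  finally have "(real n + 1)\<^sup>2 * sqrt 2 ^ (n + 1) \<le> real n ^ (2 * n) * real n ^ n"
    using 1 by (intro mult_mono) auto
  then show ?thesis by (simp add: power_add[symmetric])
qed

text \<open>All factors of \<open>C_n\<close> but the factorials in the denominator have modulus at least 1.\<close>

lemma norm_C_n_ge:
  assumes "n \<ge> 2"
  shows "1 / real n ^ (4 * n\<^sup>2) \<le> cmod (C_n n)"
proof -
  define X where "X = (2 * pi) powr (real n * (real n + 1) / 2) *
       (real n + 1) powr (((real n)\<^sup>2 + real n - 4) / 2) * (fact (n + 1)) ^ n"
  define Y :: real where "Y = (\<Prod>m = 1..n - 1. fact (m + n + 1))"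
  have "(of_nat n * (3 * of_nat n - 1) / 4 :: complex) = of_real (real n * (3 * real n - 1) / 4)" by simp
  then have "cmod ((- 1) powr (of_nat n * (3 * of_nat n - 1) / 4)) = 1"
    using norm_powr_real_powr'[of "of_real (real n * (3 * real n - 1) / 4)" "- 1"] by simp
  then have "cmod (C_n n) = \<bar>X / Y\<bar>"
    unfolding C_n_def X_def Y_def by (simp only: norm_mult norm_of_real mult_1)
  moreover have "Y > 0" unfolding Y_def by (intro prod_pos) auto
  moreover have "1 \<le> X"
  proof -
    have "0 \<le> (real n)\<^sup>2 + real n - 4" using assms power_mono[of 2 "real n" 2] by simp
    moreover have "1 \<le> 2 * pi" using pi_ge_two by simp
    ultimately have "1 * 1 * 1 \<le> X"
      unfolding X_def
      by (intro mult_mono ge_one_powr_ge_zero one_le_power fact_ge_1) (auto simp: fact_ge_1)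
    then show ?thesis by simp
  qed
  moreover have "Y \<le> real n ^ (4 * n\<^sup>2)"
  proof -
    have "Y \<le> (\<Prod>m = 1..n - 1. fact (2 * n))"
      unfolding Y_def by (intro prod_mono conjI fact_mono) auto
    also have "\<dots> = fact (2 * n) ^ (n - 1)" by simp
    also have "\<dots> \<le> (real ((2 * n) ^ (2 * n))) ^ (n - 1)"
      by (intro power_mono fact_le_power) auto
    also have "\<dots> = (real (2 * n) ^ (2 * n)) ^ (n - 1)" by (simp only: of_nat_power)
    also have "\<dots> \<le> ((real n ^ 2) ^ (2 * n)) ^ (n - 1)"
      using assms by (intro power_mono) (auto simp: power2_eq_square)
    also have "\<dots> = real n ^ (4 * n * (n - 1))" by (simp add: power_mult[symmetric])
    also have "\<dots> \<le> real n ^ (4 * n\<^sup>2)"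
      using assms by (intro power_increasing) (auto simp: power2_eq_square)
    finally show ?thesis .
  qed
  ultimately have "1 / real n ^ (4 * n\<^sup>2) \<le> X / Y" by (intro frac_le) auto
  also have "\<dots> \<le> cmod (C_n n)" using \<open>cmod (C_n n) = \<bar>X / Y\<bar>\<close> by (metis abs_ge_self)
  finally show ?thesis .
qed

section \<open>The lower bound\<close>

theorem theorem1p57:
  fixes n :: nat and h :: cpoly2
  assumes "n \<ge> 2"
    and "homogeneous2 (n + 1) h"
    and "generic2 h"
    and "max_norm2 h = 1"
  shows "\<exists>\<Omega>. d_standard_tuple n \<Omega> \<and>
    cmod (C_const n h \<Omega>) > c_prime n h ^ (6 * n ^ 3) * real n powi (- (60 * int n ^ 3))"
proof -
  \<comment> \<open>The factorization on which \<open>Sigma_disc\<close> is evaluated.\<close>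
  define v where "v = (SOME v :: nat \<Rightarrow> complex \<times> complex. h = (\<Prod>i\<le>n. linear2 (v i)))"
  have h: "h = (\<Prod>i\<le>n. linear2 (v i))"
    using someI_ex[OF ex_linear2_factorization[OF assms(2)]] unfolding v_def .
  define f where "f = poly h 1"
  have f: "f = (\<Prod>i\<le>n. lin (v i))"
    unfolding f_def by (subst h) (simp add: poly_prod dehomogenize_linear2)
  define u where "u = dual_deriv (n + 1) f"
  define w where "w = pderiv f"
  define L where "L = real n ^ (3 * n)"
  define R where "R = absdet (2 * n) (shifts n u @ shifts n w)"
  have n1: "n \<ge> 1" and rn: "real n \<ge> 1" using assms(1) by auto
  have L1: "L \<ge> 1" unfolding L_def using rn by simp
  have degf: "degree f \<le> Suc n"
    unfolding f using degree_prod_lin_le[of "{..n}" v] by simp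
  have degu: "degree u \<le> n" and degw: "degree w \<le> n"
    unfolding u_def w_def using degree_dual_deriv_le[OF degf] degree_pderiv_le_pred[OF degf] by simp_all
  have "cmod (coeff f i) \<le> sqrt 2 ^ (n + 1)" for i
    using norm_coeff_dehomogenize_le[OF h, of i] assms(4) by (simp add: f_def)
  note sum_norm_partials_le[OF this, of n]
  then have sumu: "(\<Sum>c\<le>n. cmod (coeff u c)) \<le> L" and sumw: "(\<Sum>c\<le>n. cmod (coeff w c)) \<le> L"
    unfolding u_def w_def L_def using row_norm_bound[OF assms(1)] by (auto intro: order.trans)
  have nz: "wedge (v i) (v j) \<noteq> 0" if "i < j" "j \<le> n" for i j
    using generic2_imp_wedge_nonzero[OF assms(3) h that] .
  define S where "S = (\<Prod>j\<le>n. \<Prod>i<j. cmod (wedge (v i) (v j)))"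
  have "S > 0" unfolding S_def using nz by (intro prod_pos) auto
  have RS: "R = real (n + 1) ^ (n - 1) * S\<^sup>2"
    using absdet_sylvester_partials[OF n1 nz] unfolding R_def u_def w_def f S_def by simp
  have "R > 0" unfolding RS using \<open>S > 0\<close> by simp
  have "Sigma_disc n h = (\<Prod>j\<le>n. \<Prod>i<j. (wedge (v i) (v j))\<^sup>2)"
    unfolding Sigma_disc_def Let_def v_def[symmetric] wedge_def ..
  then have Sig: "cmod (Sigma_disc n h) = S\<^sup>2"
    by (simp add: prod_norm[symmetric] norm_power prod_power_distrib S_def)
  have SR: "S\<^sup>2 \<le> R" unfolding RS using mult_right_mono[of 1 "real (n + 1) ^ (n - 1)" "S\<^sup>2"] by simp
  note minors = absdet_sylvester_minors[OF sumu degu sumw degw, folded R_def, OF \<open>R > 0\<close>]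
  have RL: "R \<le> L ^ (2 * n)"
  proof -
    obtain cs where cs: "length cs = n" "R \<le> L ^ (2 * n) * absdet n (map (monom 1) cs)"
      by (rule minors[of 0]) (auto simp: shifts_def)
    have "L ^ (2 * n) * absdet n (map (monom 1) cs) \<le> L ^ (2 * n) * 1"
      using L1 absdet_monoms_le_1[OF cs(1)] by (intro mult_left_mono) auto
    with cs(2) show ?thesis by simp
  qed
  have "\<exists>cs. length cs = 2 * n - d - 1 \<and> (\<forall>c\<in>set cs. c \<le> d) \<and>
      R \<le> L ^ (2 * n) * absdet (d + 1) (shifts (d - n + 1) u @ shifts (d - n + 1) w @ map (monom 1) cs)"
    if d: "n \<le> d" "d \<le> 2 * n - 2" for d
  proof -
    let ?k = "d - n + 1"
    have k: "?k \<le> n" "n - ?k = 2 * n - d - 1" "n + ?k = d + 1" using d n1 by auto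
    obtain cs where cs: "length cs = n - ?k"
      "R \<le> L ^ (2 * (n - ?k)) * absdet (n + ?k) (shifts ?k u @ shifts ?k w @ map (monom 1) cs)"
      using minors[OF k(1)] by blast
    let ?D = "absdet (d + 1) (shifts ?k u @ shifts ?k w @ map (monom 1) cs)"
    have "R \<le> L ^ (2 * (n - ?k)) * ?D" using cs(2) unfolding k(3) .
    also have "\<dots> \<le> L ^ (2 * n) * ?D"
      using L1 by (intro mult_right_mono power_increasing) (auto simp: absdet_def)
    finally have R: "R \<le> L ^ (2 * n) * ?D" .
    have D: "?D \<noteq> 0" using R \<open>R > 0\<close> by auto
    \<comment> \<open>A unit row beyond the last column would be zero.\<close>
    have le: "c \<le> d" if "c \<in> set cs" for c
    proof -
      have "\<exists>k<d + 1. coeff (monom 1 c :: complex poly) k \<noteq> 0"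
        by (rule absdet_nonzero_row[OF D]) (use cs(1) k d that in auto)
      then show ?thesis by (auto split: if_splits)
    qed
    show ?thesis
      by (intro exI[of _ cs] conjI ballI R le trans[OF cs(1) k(2)])
  qed
  then obtain cs where cs: "\<And>d. n \<le> d \<Longrightarrow> d \<le> 2 * n - 2 \<Longrightarrow> length (cs d) = 2 * n - d - 1"
    "\<And>d c. n \<le> d \<Longrightarrow> d \<le> 2 * n - 2 \<Longrightarrow> c \<in> set (cs d) \<Longrightarrow> c \<le> d"
    "\<And>d. n \<le> d \<Longrightarrow> d \<le> 2 * n - 2 \<Longrightarrow> R \<le> L ^ (2 * n) *
       absdet (d + 1) (shifts (d - n + 1) u @ shifts (d - n + 1) w @ map (monom 1) (cs d))"
    by metis
  define \<Omega> where "\<Omega> = tuple_of_exponents n cs"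
  have std: "d_standard_tuple n \<Omega>"
    unfolding \<Omega>_def using d_standard_tuple_of_exponents[OF n1] cs by blast
  define Q where "Q = R / (real n ^ (2 * n) * L ^ (2 * n))"
  have P: "Q \<le> cmod (P_det n d h \<Omega>)" if d: "n \<le> d" "d \<le> 2 * n - 2" for d
  proof -
    let ?D = "absdet (d + 1) (shifts (d - n + 1) u @ shifts (d - n + 1) w @ map (monom 1) (cs d))"
    have forms: "forms_of_degree (d + 1) \<Omega> = map (\<lambda>c. monomial_form c (d - c)) (cs d)"
      unfolding \<Omega>_def by (rule forms_of_degree_tuple_of_exponents[OF n1 cs(2) d])
    have "Q = (1 / real n) ^ (2 * n) * (R / L ^ (2 * n))" by (simp add: Q_def power_divide)
    also have "\<dots> \<le> (1 / real n) ^ (d + 1) * ?D"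
      using cs(3)[OF d] d rn L1 \<open>R > 0\<close>
      by (intro mult_mono power_decreasing) (auto simp: divide_le_eq mult.commute)
    also have "\<dots> \<le> cmod (P_det n d h \<Omega>)"
      unfolding u_def w_def f_def
      by (rule P_det_ge_absdet[OF assms(2) n1 d cs(1)[OF d] cs(2)[OF d] forms])
    finally show ?thesis .
  qed
  have "Q > 0" using \<open>R > 0\<close> L1 rn by (simp add: Q_def)
  have "(\<Prod>d = n..2 * n - 2. Q) \<le> (\<Prod>d = n..2 * n - 2. cmod (P_det n d h \<Omega>))"
    using P \<open>Q > 0\<close> by (intro prod_mono) auto
  moreover have "card {n..2 * n - 2} = n - 1" using assms(1) by auto
  ultimately have prodP: "Q ^ (n - 1) \<le> cmod (\<Prod>d = n..2 * n - 2. P_det n d h \<Omega>)"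
    by (simp add: prod_norm[symmetric])
  have "cmod (Sigma_disc n h powr (1 / 2 - of_nat n)) = (S\<^sup>2) powr (1 / 2 - real n)"
    using norm_powr_real_powr'[of "of_real (1 / 2 - real n)" "Sigma_disc n h"] Sig by simp
  also have "\<dots> \<ge> R powr (1 / 2 - real n)"
    using SR \<open>S > 0\<close> n1 by (intro powr_mono2') auto
  finally have powSig: "R powr (1 / 2 - real n) \<le> cmod (Sigma_disc n h powr (1 / 2 - of_nat n))" .
  have "1 / L ^ n = L powr (- real n)" using L1 by (simp add: powr_minus_divide powr_realpow)
  also have "\<dots> = (L ^ (2 * n)) powr (- 1 / 2)"
    using L1 by (simp add: powr_realpow[symmetric] powr_powr)
  also have "\<dots> \<le> R powr (- 1 / 2)" using RL \<open>R > 0\<close> by (intro powr_mono2') auto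
  also have "- 1 / 2 = 1 / 2 - real n + real (n - 1)" using n1 by (simp add: of_nat_diff)
  also have "R powr \<dots> = R powr (1 / 2 - real n) * R ^ (n - 1)"
    using \<open>R > 0\<close> by (simp only: powr_add powr_realpow)
  finally have R2: "1 / L ^ n \<le> R powr (1 / 2 - real n) * R ^ (n - 1)" .
  \<comment> \<open>The exponents come from \<open>C\<^sub>n\<close>, from \<open>L\<^sup>n\<close> and from the \<open>n - 1\<close> determinants \<open>P\<^sub>d\<close>.\<close>
  define E where "E = 4 * n\<^sup>2 + 3 * n * n + (2 * n + 3 * n * (2 * n)) * (n - 1)"
  have "real n ^ E = real n ^ (4 * n\<^sup>2) * L ^ n * (real n ^ (2 * n) * L ^ (2 * n)) ^ (n - 1)"
    unfolding E_def L_def by (simp only: power_add[symmetric] power_mult[symmetric])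
  then have "1 / real n ^ E = 1 / real n ^ (4 * n\<^sup>2) * (1 / L ^ n) * (1 / (real n ^ (2 * n) * L ^ (2 * n)) ^ (n - 1))"
    by simp
  also have "\<dots> \<le> 1 / real n ^ (4 * n\<^sup>2) * (R powr (1 / 2 - real n) * R ^ (n - 1)) *
      (1 / (real n ^ (2 * n) * L ^ (2 * n)) ^ (n - 1))"
    using R2 L1 rn by (intro mult_right_mono mult_left_mono) auto
  also have "\<dots> = 1 / real n ^ (4 * n\<^sup>2) * R powr (1 / 2 - real n) * Q ^ (n - 1)"
    by (simp add: Q_def power_divide)
  also have "\<dots> \<le> cmod (C_const n h \<Omega>)"
    unfolding C_const_def norm_mult
    using norm_C_n_ge[OF assms(1)] powSig prodP \<open>Q > 0\<close> by (intro mult_mono) auto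
  finally have CE: "1 / real n ^ E \<le> cmod (C_const n h \<Omega>)" .
  have "E \<le> 7 * n\<^sup>2 + (2 * n + 6 * n\<^sup>2) * n"
    unfolding E_def by (simp add: power2_eq_square)
  also have "\<dots> < 60 * n ^ 3"
  proof -
    have "n\<^sup>2 \<le> n ^ 3" "0 < n ^ 3" using n1 by (auto intro: power_increasing)
    then show ?thesis by (simp add: power2_eq_square power3_eq_cube algebra_simps)
  qed
  finally have "real n ^ E < real n ^ (60 * n ^ 3)"
    using assms(1) by (intro power_strict_increasing) auto
  then have "1 / real n ^ (60 * n ^ 3) < 1 / real n ^ E"
    using rn by (intro divide_strict_left_mono) auto
  moreover have "real n powi (- (60 * int n ^ 3)) = 1 / real n ^ (60 * n ^ 3)"
  proof -
    have "- (60 * int n ^ 3) = - int (60 * n ^ 3)" by simp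
    then show ?thesis by (simp only: power_int_minus power_int_of_nat divide_inverse mult_1)
  qed
  moreover have "c_prime n h ^ (6 * n ^ 3) \<le> 1"
    using c_prime_bounds[OF n1 assms(3) h] by (intro power_le_one) auto
  then have "c_prime n h ^ (6 * n ^ 3) * (1 / real n ^ (60 * n ^ 3)) \<le> 1 * (1 / real n ^ (60 * n ^ 3))"
    by (intro mult_right_mono) auto
  ultimately show ?thesis using std CE by (intro exI[of _ \<Omega>]) auto
qed

end
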